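(* Let $G$ be a penny graph on $n$ nodes, where $n \geq 5$, and let $\overline{G}$ denote its complement graph. Then: 1. if $G$ is a path, a disjoint union of paths, or a cycle, then $\mu(\overline{G}) \geq n-3$; 2. otherwise, $\mu(\overline{G}) \geq n-4$. Here $\mu$ denotes the Colin de Verdière graph number.
   Context: Graphs are finite, simple and undirected; $E(G)$ is the edge set of $G$, and $\overline{G}$ is the complement of $G$ (same nodes, $\{i,j\}$ with $i\ne j$ is an edge of $\overline{G}$ iff it is not an edge of $G$). Penny graph: a graph $G$ on $n$ nodes is a penny graph if there is a one-to-one correspondence between its nodes and a set of $n$ closed unit-diameter disks in the plane with pairwise disjoint interiors such that two nodes are adjacent iff the corresponding disks touch. Equivalently, there are points $p^1,\dots,p^n \in \mathbb{R}^2$ (the disk centers, called a realization of $G$) such that for all $i \neq j$: $\|p^i-p^j\|^2 = 1$ if $\{i,j\}\in E(G)$ and $\|p^i-p^j\|^2 > 1$ if $\{i,j\}\in E(\overline{G})$. $G$-matrix: for a graph $G$ on $n$ nodes, a $G$-matrix is a real symmetric $n\times n$ matrix $A$ with $a_{ij}=0$ for all $\{i,j\}\in E(\overline{G})$ (no condition on diagonal entries). It is well signed if in addition $a_{ij}<0$ for all $\{i,j\}\in E(G)$. Colin de Verdière number: for a connected graph $G$ on $n$ nodes, $\mu(G)$ is the maximum corank (dimension of the null space) of an $n\times n$ matrix $M$ such that (M1) $M$ is a well-signed $G$-matrix; (M2) $M$ has exactly one negative eigenvalue (counted with multiplicity); (M3) there is no nonzero $\overline{G}$-matrix $X$ with all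 diagonal entries equal to $0$ such that $MX=0$. If $G$ is disconnected with connected components $G_1,\dots,G_k$ and $G$ has at least one edge, then $\mu(G)=\max\{\mu(G_1),\dots,\mu(G_k)\}$; the edgeless graph on $n\ge 2$ nodes has $\mu=1$, and $\mu(K_1)=0$. *)

theory Defs
  imports "HOL-Analysis.Analysis"
begin

section \<open>Finite simple undirected graphs\<close>

text \<open>A graph is a finite node set \<open>V\<close> together with a set \<open>E\<close> of edges, each edge being a
  two-element subset of \<open>V\<close>.\<close>

definition simple_graph :: "'a set \<Rightarrow> 'a set set \<Rightarrow> bool" where
  "simple_graph V E \<longleftrightarrow> finite V \<and> (\<forall>e\<in>E. \<exists>u\<in>V. \<exists>v\<in>V. u \<noteq> v \<and> e = {u, v})"

definition compl_edges :: "'a set \<Rightarrow> 'a set set \<Rightarrow> 'a set set" where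
  "compl_edges V E = {{u, v} | u v. u \<in> V \<and> v \<in> V \<and> u \<noteq> v \<and> {u, v} \<notin> E}"

definition joined :: "'a set set \<Rightarrow> 'a \<Rightarrow> 'a \<Rightarrow> bool" where
  "joined E = (\<lambda>u v. {u, v} \<in> E)\<^sup>*\<^sup>*"

definition connected_graph :: "'a set \<Rightarrow> 'a set set \<Rightarrow> bool" where
  "connected_graph V E \<longleftrightarrow> V \<noteq> {} \<and> (\<forall>u\<in>V. \<forall>v\<in>V. joined E u v)"

text \<open>Node sets of the connected components; the component itself is the subgraph induced on it.\<close>

definition components_of :: "'a set \<Rightarrow> 'a set set \<Rightarrow> 'a set set" where
  "components_of V E = {{v \<in> V. joined E u v} | u. u \<in> V}"

definition induced_edges :: "'a set set \<Rightarrow> 'a set \<Rightarrow> 'a set set" where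
  "induced_edges E C = {e \<in> E. e \<subseteq> C}"

text \<open>A single node counts as a path, so an isolated node may occur in a disjoint union of paths.\<close>

definition path_graph :: "'a set \<Rightarrow> 'a set set \<Rightarrow> bool" where
  "path_graph V E \<longleftrightarrow> V \<noteq> {} \<and>
     (\<exists>f. bij_betw f {..<card V} V \<and> E = {{f i, f (Suc i)} | i. Suc i < card V})"

definition disjoint_union_of_paths :: "'a set \<Rightarrow> 'a set set \<Rightarrow> bool" where
  "disjoint_union_of_paths V E \<longleftrightarrow>
     (\<forall>C\<in>components_of V E. path_graph C (induced_edges E C))"

definition cycle_graph :: "'a set \<Rightarrow> 'a set set \<Rightarrow> bool" where
  "cycle_graph V E \<longleftrightarrow> card V \<ge> 3 \<and>
     (\<exists>f. bij_betw f {..<card V} V \<and> E = {{f i, f (Suc i mod card V)} | i. i < card V})"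


section \<open>Penny graphs\<close>

text \<open>Disks with disjoint interiors touch iff they have a common point.\<close>

definition penny_graph :: "'a set \<Rightarrow> 'a set set \<Rightarrow> bool" where
  "penny_graph V E \<longleftrightarrow>
     (\<exists>D :: 'a \<Rightarrow> (real ^ 2) set.
        inj_on D V \<and>
        (\<forall>i\<in>V. \<exists>c. D i = cball c (1/2)) \<and>
        (\<forall>i\<in>V. \<forall>j\<in>V. i \<noteq> j \<longrightarrow>
           interior (D i) \<inter> interior (D j) = {} \<and>
           ({i, j} \<in> E \<longleftrightarrow> D i \<inter> D j \<noteq> {})))"

lemma penny_graph_iff_realization:
  "penny_graph V E \<longleftrightarrow>
     (\<exists>p :: 'a \<Rightarrow> real ^ 2. \<forall>i\<in>V. \<forall>j\<in>V. i \<noteq> j \<longrightarrow>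
        (if {i, j} \<in> E then (norm (p i - p j))\<^sup>2 = 1 else (norm (p i - p j))\<^sup>2 > 1))"
  (is "?L \<longleftrightarrow> ?R")
proof -
  have int: "interior (cball a (1/2)) \<inter> interior (cball b (1/2)) = {} \<longleftrightarrow> dist a b \<ge> 1"
    for a b :: "real ^ 2"
  proof
    assume "dist a b \<ge> 1"
    then show "interior (cball a (1/2)) \<inter> interior (cball b (1/2)) = {}"
      by (simp add: disjoint_ballI)
  next
    assume h: "interior (cball a (1/2)) \<inter> interior (cball b (1/2)) = {}"
    show "dist a b \<ge> 1"
    proof (rule ccontr)
      assume "\<not> dist a b \<ge> 1"
      then have "midpoint a b \<in> interior (cball a (1/2)) \<inter> interior (cball b (1/2))"
        by (simp add: dist_midpoint)
      with h show False by blast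
    qed
  qed
  have meet: "cball a (1/2) \<inter> cball b (1/2) \<noteq> {} \<longleftrightarrow> dist a b \<le> 1" for a b :: "real ^ 2"
  proof
    assume "dist a b \<le> 1"
    then have "midpoint a b \<in> cball a (1/2) \<inter> cball b (1/2)"
      by (simp add: dist_midpoint)
    then show "cball a (1/2) \<inter> cball b (1/2) \<noteq> {}" by blast
  next
    assume "cball a (1/2) \<inter> cball b (1/2) \<noteq> {}"
    then obtain x where "dist a x \<le> 1/2" "dist b x \<le> 1/2" by auto
    then show "dist a b \<le> 1" using dist_triangle2[of a b x] by linarith
  qed
  have sq1: "(norm (a - b))\<^sup>2 = 1 \<longleftrightarrow> dist a b = 1" for a b :: "real ^ 2"
    using power2_eq_iff_nonneg[of "norm (a - b)" 1] by (simp add: dist_norm)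
  have sq2: "(norm (a - b))\<^sup>2 > 1 \<longleftrightarrow> dist a b > 1" for a b :: "real ^ 2"
    using abs_square_le_1[of "norm (a - b)"] by (auto simp add: dist_norm)
  show ?thesis
  proof
    assume ?L
    then obtain D :: "'a \<Rightarrow> (real ^ 2) set" where D: "\<forall>i\<in>V. \<exists>c. D i = cball c (1/2)"
      "\<forall>i\<in>V. \<forall>j\<in>V. i \<noteq> j \<longrightarrow> interior (D i) \<inter> interior (D j) = {} \<and>
           ({i, j} \<in> E \<longleftrightarrow> D i \<inter> D j \<noteq> {})"
      unfolding penny_graph_def by (elim exE conjE) (rule that)
    from D(1) obtain p where p: "\<forall>i\<in>V. D i = cball (p i) (1/2)" by metis
    have "if {i, j} \<in> E then (norm (p i - p j))\<^sup>2 = 1 else (norm (p i - p j))\<^sup>2 > 1"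
      if ij: "i \<in> V" "j \<in> V" "i \<noteq> j" for i j
    proof -
      have "dist (p i) (p j) \<ge> 1"
        using D(2)[rule_format, OF ij] p ij int[of "p i" "p j"] by metis
      moreover have "{i, j} \<in> E \<longleftrightarrow> dist (p i) (p j) \<le> 1"
        using D(2)[rule_format, OF ij] p ij meet[of "p i" "p j"] by metis
      ultimately show ?thesis unfolding sq1 sq2 by auto
    qed
    then show ?R by blast
  next
    assume ?R
    then obtain p :: "'a \<Rightarrow> real ^ 2" where p: "\<forall>i\<in>V. \<forall>j\<in>V. i \<noteq> j \<longrightarrow>
      (if {i, j} \<in> E then dist (p i) (p j) = 1 else dist (p i) (p j) > 1)"
      unfolding sq1 sq2 by (elim exE) (rule that)
    have p1: "dist (p i) (p j) \<ge> 1" "{i, j} \<in> E \<longleftrightarrow> dist (p i) (p j) \<le> 1"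
      if "i \<in> V" "j \<in> V" "i \<noteq> j" for i j
      using p[rule_format, OF that] by (auto split: if_splits)
    have inj: "inj_on (\<lambda>i. cball (p i) (1/2)) V"
    proof (rule inj_onI, rule ccontr)
      fix i j assume ij: "i \<in> V" "j \<in> V" "cball (p i) (1/2) = cball (p j) (1/2)" "i \<noteq> j"
      then have "p i = p j" by (simp add: cball_eq_cball_iff)
      with p1(1)[OF ij(1,2,4)] show False by simp
    qed
    show ?L
      unfolding penny_graph_def
    proof (intro exI conjI ballI impI)
      show "inj_on (\<lambda>i. cball (p i) (1/2)) V" by (fact inj)
    next
      fix i j assume ij: "i \<in> V" "j \<in> V" "i \<noteq> j"
      show "interior (cball (p i) (1/2)) \<inter> interior (cball (p j) (1/2)) = {}"
        unfolding int by (rule p1(1)[OF ij])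
      show "{i, j} \<in> E \<longleftrightarrow> cball (p i) (1/2) \<inter> cball (p j) (1/2) \<noteq> {}"
        unfolding meet by (rule p1(2)[OF ij])
    qed (rule refl)
  qed
qed


section \<open>The Colin de Verdiere number\<close>

text \<open>A real matrix with rows and columns indexed by \<open>V\<close> is represented by the matrix over the
  whole (finite) type that is zero outside \<open>V \<times> V\<close>, and a vector indexed by \<open>V\<close> by an
  element of \<open>coord_space V\<close>. Null spaces and eigenspaces are taken inside \<open>coord_space V\<close>,
  so the padding contributes nothing to them.\<close>

definition coord_space :: "'a set \<Rightarrow> (real ^ 'a::finite) set" where
  "coord_space V = {x. \<forall>i. i \<notin> V \<longrightarrow> x $ i = 0}"

definition graph_matrix :: "'a set \<Rightarrow> 'a set set \<Rightarrow> real ^ 'a ^ 'a::finite \<Rightarrow> bool" where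
  "graph_matrix V E A \<longleftrightarrow>
     (\<forall>i j. i \<notin> V \<or> j \<notin> V \<longrightarrow> A $ i $ j = 0) \<and>
     transpose A = A \<and>
     (\<forall>i j. {i, j} \<in> compl_edges V E \<longrightarrow> A $ i $ j = 0)"

definition well_signed :: "'a set set \<Rightarrow> real ^ 'a ^ 'a::finite \<Rightarrow> bool" where
  "well_signed E A \<longleftrightarrow> (\<forall>i j. {i, j} \<in> E \<and> i \<noteq> j \<longrightarrow> A $ i $ j < 0)"

definition eigenspace :: "'a set \<Rightarrow> real ^ 'a ^ 'a::finite \<Rightarrow> real \<Rightarrow> (real ^ 'a) set" where
  "eigenspace V M t = {x \<in> coord_space V. M *v x = t *\<^sub>R x}"

definition eigenvalue :: "'a set \<Rightarrow> real ^ 'a ^ 'a::finite \<Rightarrow> real \<Rightarrow> bool" where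
  "eigenvalue V M t \<longleftrightarrow> (\<exists>x\<in>eigenspace V M t. x \<noteq> 0)"

text \<open>Only used for symmetric matrices, for which the dimension of an eigenspace is the
  multiplicity of the eigenvalue (geometric and algebraic multiplicities agree), and for which
  the eigenvalues are real.\<close>

definition num_negative_eigenvalues :: "'a set \<Rightarrow> real ^ 'a ^ 'a::finite \<Rightarrow> nat" where
  "num_negative_eigenvalues V M = (\<Sum>t | t < 0 \<and> eigenvalue V M t. dim (eigenspace V M t))"

definition corank :: "'a set \<Rightarrow> real ^ 'a ^ 'a::finite \<Rightarrow> nat" where
  "corank V M = dim {x \<in> coord_space V. M *v x = 0}"

definition colin_de_verdiere_matrix ::
    "'a set \<Rightarrow> 'a set set \<Rightarrow> real ^ 'a ^ 'a::finite \<Rightarrow> bool" where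
  "colin_de_verdiere_matrix V E M \<longleftrightarrow>
     (graph_matrix V E M \<and> well_signed E M) \<and>
     num_negative_eigenvalues V M = 1 \<and>
     \<not> (\<exists>X. X \<noteq> 0 \<and> graph_matrix V (compl_edges V E) X \<and> (\<forall>i\<in>V. X $ i $ i = 0) \<and> M ** X = 0)"

definition mu_connected :: "('a::finite) set \<Rightarrow> 'a set set \<Rightarrow> nat" where
  "mu_connected V E = Max {corank V M | M. colin_de_verdiere_matrix V E M}"

definition mu :: "('a::finite) set \<Rightarrow> 'a set set \<Rightarrow> nat" where
  "mu V E =
     (if E = {} then (if card V \<ge> 2 then 1 else 0)
      else if connected_graph V E then mu_connected V E
      else Max {mu_connected C (induced_edges E C) | C. C \<in> components_of V E})"

end

theory Submission
  imports Defs
begin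

text \<open>
  Let \<open>p\<close> be the disk centres and let \<open>M\<close> be the matrix with entries \<open>1 - |p i - p j|^2\<close>. It is a
  well-signed matrix for the complement graph: an entry is 0 for touching disks and negative for
  disjoint ones. Expanding the square writes \<open>M\<close> through the all-ones vector, the vector of
  squared norms and the two coordinate vectors, so the rank is at most 4 and the corank at least
  \<open>n - 4\<close>. If the centres lie on a line, or on a circle around the origin, one of these vectors
  is redundant and the corank is at least \<open>n - 3\<close>. A union of paths can be realized on a line and
  a cycle by a regular polygon (\<open>disjoint_union_of_paths_positions\<close>,
  \<open>cycle_graph_contact_realization\<close>), and this gives the better bound for these graphs.

  On vectors with coordinate sum 0 the quadratic form of \<open>M\<close> is twice the squared norm of
  \<open>\<Sum>i. x i * p i\<close> (\<open>disk_matrix_form_on_balanced\<close>). As this is nonnegative on a hyperplane, \<open>M\<close> has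
  at most one negative eigenvalue. It has one, because among five points at mutual distances at
  least 1 there are two with squared distance more than 2 (\<open>exists_distant_pair\<close>). It also follows
  that a kernel vector has coordinate sum 0 and annihilates the points (\<open>kernel_balanced\<close>).

  Consequently a matrix \<open>X\<close> that violates (M3) is an equilibrium stress on the touching pairs. Its
  support has a leftmost node; this node touches at most three others of the support, since they
  lie in a half-plane and are seen under angles of at least \<open>\<pi>/3\<close>, and three points of a circle are
  affinely independent. Hence \<open>X = 0\<close> (\<open>no_contact_stress\<close>).

  If the complement graph is disconnected, its Colin de Verdiere number is the maximum over the
  components, and \<open>M\<close> is block diagonal. A Perron-Frobenius argument shows that the kernel of \<open>M\<close>
  lies in the block with the negative eigenvalue (\<open>kernel_in_negative_block\<close>), so this one
  component attains the bound. The connected case is the one with a single block.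
\<close>

section \<open>Separated points in the plane\<close>

lemma spread_of_separated_reals:
  fixes a :: "'b \<Rightarrow> real"
  assumes "finite S" "S \<noteq> {}"
    and "\<And>i j. i \<in> S \<Longrightarrow> j \<in> S \<Longrightarrow> i \<noteq> j \<Longrightarrow> \<bar>a i - a j\<bar> \<ge> \<delta>"
  shows "\<exists>i\<in>S. \<exists>j\<in>S. a j - a i \<ge> (real (card S) - 1) * \<delta>"
  using assms
proof (induction S rule: finite_ranking_induct[where f = a])
  case empty
  then show ?case by simp
next
  case (insert x S)
  show ?case
  proof (cases "S = {} \<or> x \<in> S")
    case True
    then show ?thesis
    proof
      assume "x \<in> S"
      then have "insert x S = S" "S \<noteq> {}" by auto
      then show ?thesis using insert.IH insert.prems by metis
    qed simp
  next
    case False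
    have "\<exists>i\<in>S. \<exists>j\<in>S. (real (card S) - 1) * \<delta> \<le> a j - a i"
      using False insert.prems by (intro insert.IH) auto
    then obtain i j where ij: "i \<in> S" "j \<in> S" "(real (card S) - 1) * \<delta> \<le> a j - a i"
      by blast
    have "\<bar>a j - a x\<bar> \<ge> \<delta>"
      using ij False insert.prems(2) by blast
    then have "a x - a j \<ge> \<delta>"
      using insert.hyps(2)[OF ij(2)] by simp
    then have "a x - a i \<ge> (real (card (insert x S)) - 1) * \<delta>"
      using False ij(3) insert.hyps(1) by (simp add: algebra_simps)
    then show ?thesis using ij by blast
  qed
qed

text \<open>The half-open half-plane with arguments in \<open>(-\<pi>/2, \<pi>/2]\<close>. It contains exactly one of \<open>z\<close> and
  \<open>-z\<close> for every nonzero \<open>z\<close>, so it orders the plane lexicographically, and arguments of its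
  elements can be subtracted without wrapping around.\<close>

definition right_half_plane :: "complex set" where
  "right_half_plane = {z. Re z > 0 \<or> (Re z = 0 \<and> Im z > 0)}"

lemma exists_leftmost_point:
  fixes p :: "'b \<Rightarrow> complex"
  assumes "finite S" "S \<noteq> {}" "inj_on p S"
  obtains i where "i \<in> S" "\<And>j. j \<in> S \<Longrightarrow> j \<noteq> i \<Longrightarrow> p j - p i \<in> right_half_plane"
proof -
  obtain m where m: "m \<in> S" "\<And>j. j \<in> S \<Longrightarrow> Re (p m) \<le> Re (p j)"
    using ex_min_if_finite[of "(\<lambda>j. Re (p j)) ` S"] assms(1,2) by fastforce
  define T where "T = {j \<in> S. Re (p j) = Re (p m)}"
  have T: "finite T" "T \<noteq> {}" using m assms(1) by (auto simp: T_def)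
  obtain i where i: "i \<in> T" "\<And>j. j \<in> T \<Longrightarrow> Im (p i) \<le> Im (p j)"
    using ex_min_if_finite[of "(\<lambda>j. Im (p j)) ` T"] T by fastforce
  show ?thesis
  proof
    show "i \<in> S" using i by (simp add: T_def)
    fix j assume j: "j \<in> S" "j \<noteq> i"
    then have ne: "p j \<noteq> p i" using assms(3) i by (auto simp: T_def inj_on_def)
    have re: "Re (p i) = Re (p m)" using i by (simp add: T_def)
    show "p j - p i \<in> right_half_plane"
    proof (cases "Re (p j) = Re (p m)")
      case True
      then have "j \<in> T" using j by (simp add: T_def)
      then have "Im (p i) \<le> Im (p j)" using i by blast
      then show ?thesis using True re ne
        by (auto simp: right_half_plane_def complex_eq_iff)
    next
      case False
      then show ?thesis using m(2)[OF j(1)] re by (simp add: right_half_plane_def)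
    qed
  qed
qed

lemma inner_eq_cos_Arg:
  "z \<bullet> w = cmod z * cmod w * cos (Arg z - Arg w)"
proof -
  have "z \<bullet> w = rcis (cmod z) (Arg z) \<bullet> rcis (cmod w) (Arg w)"
    by (simp add: rcis_cmod_Arg)
  also have "\<dots> = cmod z * cmod w * cos (Arg z - Arg w)"
    unfolding inner_complex_def by (simp add: cos_diff algebra_simps)
  finally show ?thesis .
qed

lemma Arg_right_half_plane:
  assumes "z \<in> right_half_plane"
  shows "- (pi / 2) < Arg z" "Arg z \<le> pi / 2" "z \<noteq> 0"
proof -
  show nz: "z \<noteq> 0" using assms by (auto simp: right_half_plane_def)
  have "\<bar>Arg z\<bar> < pi / 2" if "Re z > 0" using that Arg_Re_pos by blast
  moreover have "\<bar>Arg z\<bar> \<le> pi / 2" "Arg z > 0" if "Re z = 0" "Im z > 0"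
    using that Arg_Re_nonneg[of z] Arg_pos_iff[of z] by auto
  ultimately show "- (pi / 2) < Arg z" "Arg z \<le> pi / 2"
    using assms pi_gt_zero unfolding right_half_plane_def by (smt (verit) mem_Collect_eq)+
qed

text \<open>Inside the half-plane a bound \<open>c\<close> on the cosine of the angle between two vectors is a lower bound
  \<open>arccos c\<close> on the difference of their arguments, so the arguments are separated real numbers in
  an interval of length less than \<open>\<pi>\<close>.\<close>

lemma angular_spread:
  fixes u :: "'b \<Rightarrow> complex"
  assumes "finite S" "S \<noteq> {}" "\<bar>c\<bar> \<le> 1"
    and half: "\<And>j. j \<in> S \<Longrightarrow> u j \<in> right_half_plane"
    and sep: "\<And>j k. j \<in> S \<Longrightarrow> k \<in> S \<Longrightarrow> j \<noteq> k \<Longrightarrow> u j \<bullet> u k \<le> c * (cmod (u j) * cmod (u k))"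
  shows "\<exists>i\<in>S. \<exists>j\<in>S. (real (card S) - 1) * arccos c \<le> Arg (u j) - Arg (u i)
    \<and> Arg (u j) - Arg (u i) < pi"
proof -
  have bound: "\<bar>Arg (u j) - Arg (u k)\<bar> < pi" if "j \<in> S" "k \<in> S" for j k
    using Arg_right_half_plane[OF half[OF that(1)]] Arg_right_half_plane[OF half[OF that(2)]]
    by linarith
  have "\<bar>Arg (u j) - Arg (u k)\<bar> \<ge> arccos c" if jk: "j \<in> S" "k \<in> S" "j \<noteq> k" for j k
  proof -
    have "cmod (u j) * cmod (u k) > 0"
      using half[OF jk(1)] half[OF jk(2)] Arg_right_half_plane(3) by simp
    moreover have "cmod (u j) * cmod (u k) * cos (Arg (u j) - Arg (u k))
        \<le> cmod (u j) * cmod (u k) * c"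
      using sep[OF jk] by (simp add: inner_eq_cos_Arg mult.commute)
    ultimately have "cos (Arg (u j) - Arg (u k)) \<le> c"
      by (simp add: mult_le_cancel_left_pos)
    then have "cos \<bar>Arg (u j) - Arg (u k)\<bar> \<le> c" by simp
    then have "arccos c \<le> arccos (cos \<bar>Arg (u j) - Arg (u k)\<bar>)"
      using assms(3) by (subst arccos_le_mono) auto
    also have "\<dots> = \<bar>Arg (u j) - Arg (u k)\<bar>"
      using bound[OF jk(1,2)] by (intro arccos_cos) auto
    finally show ?thesis .
  qed
  then show ?thesis
    using spread_of_separated_reals[OF assms(1,2), of "arccos c" "\<lambda>j. Arg (u j)"] bound
    by (metis abs_ge_self order_le_less_trans)
qed

text \<open>Points at distance 1 from a common point and at least 1 from each other are seen under angles of
  at least \<open>\<pi>/3\<close>; four of them would need an angle of \<open>\<pi>\<close>, which the half-plane does not offer.\<close>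

lemma at_most_three_unit_neighbours:
  fixes u :: "'b \<Rightarrow> complex"
  assumes fin: "finite S"
    and half: "\<And>j. j \<in> S \<Longrightarrow> u j \<in> right_half_plane"
    and unit: "\<And>j. j \<in> S \<Longrightarrow> cmod (u j) = 1"
    and sep: "\<And>j k. j \<in> S \<Longrightarrow> k \<in> S \<Longrightarrow> j \<noteq> k \<Longrightarrow> dist (u j) (u k) \<ge> 1"
  shows "card S \<le> 3"
proof (cases "S = {}")
  case False
  have "u j \<bullet> u k \<le> 1 / 2 * (cmod (u j) * cmod (u k))" if "j \<in> S" "k \<in> S" "j \<noteq> k" for j k
  proof -
    have "(dist (u j) (u k))\<^sup>2 \<ge> 1" using sep[OF that] by simp
    moreover have "(dist (u j) (u k))\<^sup>2 = (cmod (u j))\<^sup>2 + (cmod (u k))\<^sup>2 - 2 * (u j \<bullet> u k)"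
      by (simp add: dist_norm power2_norm_eq_inner inner_diff inner_commute)
    ultimately show ?thesis using unit[OF that(1)] unit[OF that(2)] by simp
  qed
  then have "\<exists>i\<in>S. \<exists>j\<in>S. (real (card S) - 1) * arccos (1/2) \<le> Arg (u j) - Arg (u i)
      \<and> Arg (u j) - Arg (u i) < pi"
    using half by (intro angular_spread[OF fin False]) auto
  then obtain i j where ij: "Arg (u j) - Arg (u i) \<ge> (real (card S) - 1) * arccos (1/2)"
    "Arg (u j) - Arg (u i) < pi"
    by blast
  have "(real (card S) - 1) * pi = 3 * ((real (card S) - 1) * arccos (1/2))" by simp
  then have "(real (card S) - 1) * pi < 3 * pi" using ij by linarith
  then have "real (card S) - 1 < 3" using pi_gt_zero mult_less_cancel_right_pos by blast
  then show ?thesis by simp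
qed simp

text \<open>Three points of a circle are never collinear, because a line meets a circle at most twice.\<close>

lemma affinely_independent_on_circle:
  fixes u :: "'b \<Rightarrow> complex"
  assumes fin: "finite S" and card: "card S \<le> 3"
    and inj: "inj_on u S"
    and unit: "\<And>j. j \<in> S \<Longrightarrow> cmod (u j) = 1"
    and sum0: "(\<Sum>j\<in>S. c j) = 0" and sum1: "(\<Sum>j\<in>S. c j *\<^sub>R u j) = 0"
    and k: "k \<in> S"
  shows "c k = 0"
proof (rule ccontr)
  assume ck: "c k \<noteq> 0"
  have "card (S - {k}) \<le> 2" using card k fin by simp
  moreover have "S = insert k (S - {k})" using k by blast
  ultimately consider "S = {k}" | a where "S = {k, a}" "a \<noteq> k"
    | a b where "S = {k, a, b}" "a \<noteq> k" "b \<noteq> k" "a \<noteq> b"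
  proof -
    assume 1: "card (S - {k}) \<le> 2" and S: "S = insert k (S - {k})"
    consider "card (S - {k}) = 0" | "card (S - {k}) = 1" | "card (S - {k}) = 2"
      using 1 by linarith
    then show ?thesis
    proof cases
      case 1
      then have "S = {k}" using S fin by auto
      then show ?thesis by (rule that(1))
    next
      case 2
      then obtain a where "S - {k} = {a}" by (auto simp: card_Suc_eq numeral_eq_Suc)
      then have "S = {k, a}" "a \<noteq> k" using S by auto
      then show ?thesis by (rule that(2))
    next
      case 3
      then obtain a b where "S - {k} = {a, b}" "a \<noteq> b"
        unfolding card_2_iff by blast
      then have "S = {k, a, b}" "a \<noteq> k" "b \<noteq> k" "a \<noteq> b" using S by auto
      then show ?thesis by (rule that(3))
    qed
  qed
  then show False
  proof cases
    case 1
    then show False using sum0 ck by simp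
  next
    case 2
    then have "c a = - c k" using sum0 by simp
    then have "c k *\<^sub>R (u k - u a) = 0" using 2 sum1 by (simp add: algebra_simps)
    then have "u k = u a" using ck by simp
    then show False using inj 2 by (auto simp: inj_on_def)
  next
    case 3
    have ne: "u k \<noteq> u a" "u k \<noteq> u b" "u a \<noteq> u b"
      using inj 3 by (auto simp: inj_on_def)
    have cb: "c b = - c k - c a" using sum0 3 by simp
    define x y where "x = u k - u b" and "y = u a - u b"
    have eq: "c k *\<^sub>R x + c a *\<^sub>R y = 0"
      using sum1 3 by (simp add: cb x_def y_def algebra_simps)
    \<comment> \<open>The points are \<open>u b + t y\<close>, \<open>u b + y\<close> and \<open>u b\<close>, so the circle forces \<open>t\<close> to be 0 or 1.\<close>
    define t where "t = - c a / c k"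
    have "c k *\<^sub>R x = c k *\<^sub>R (t *\<^sub>R y)" using eq ck by (simp add: t_def eq_neg_iff_add_eq_0)
    then have xt: "x = t *\<^sub>R y" using ck by (metis scaleR_cancel_left)
    have "cmod (u b + x) = 1" "cmod (u b + y) = 1" "cmod (u b) = 1"
      using unit 3 by (auto simp: x_def y_def)
    then have n: "(u b + x) \<bullet> (u b + x) = 1" "(u b + y) \<bullet> (u b + y) = 1" "u b \<bullet> u b = 1"
      by (simp_all add: norm_eq_1)
    from n have e1: "2 * (u b \<bullet> y) = - (y \<bullet> y)"
      by (simp add: inner_add_left inner_add_right inner_commute)
    have "2 * t * (u b \<bullet> y) + t * t * (y \<bullet> y) = 0"
      using n unfolding xt by (simp add: inner_add_left inner_add_right inner_commute)
    then have "t * (2 * (u b \<bullet> y)) + t * t * (y \<bullet> y) = 0" by (simp add: algebra_simps)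
    then have "t * (t - 1) * (y \<bullet> y) = 0" unfolding e1 by (simp add: algebra_simps)
    moreover have "y \<bullet> y \<noteq> 0" using ne by (simp add: y_def)
    ultimately have "t = 0 \<or> t = 1" by simp
    then show False using xt ne by (auto simp: x_def y_def)
  qed
qed

text \<open>If all squared distances were at most 2, every triangle would be non-obtuse, so the other four
  points would be seen from the leftmost one within a right angle. But the law of cosines keeps
  the angle between any two of them above \<open>\<pi>/6\<close>: with lengths between 1 and \<open>sqrt 2\<close> and mutual
  distance at least 1 its cosine is at most 4/5. Four directions thus span more than \<open>\<pi>/2\<close>. The
  vertices of a square show that 5 points are needed.\<close>

lemma exists_distant_pair:
  fixes p :: "'b \<Rightarrow> complex"
  assumes fin: "finite V" and card: "card V \<ge> 5"
    and sep: "\<And>i j. i \<in> V \<Longrightarrow> j \<in> V \<Longrightarrow> i \<noteq> j \<Longrightarrow> dist (p i) (p j) \<ge> 1"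
  shows "\<exists>i\<in>V. \<exists>j\<in>V. (dist (p i) (p j))\<^sup>2 > 2"
proof (rule ccontr)
  assume contr: "\<not> ?thesis"
  have le2: "(dist (p i) (p j))\<^sup>2 \<le> 2" if ij: "i \<in> V" "j \<in> V" for i j
    using ij contr by (meson not_le)
  have inj: "inj_on p V"
    using sep by (force simp: inj_on_def)
  have ne: "V \<noteq> {}" using card by auto
  obtain c where c: "c \<in> V" "\<And>j. j \<in> V \<Longrightarrow> j \<noteq> c \<Longrightarrow> p j - p c \<in> right_half_plane"
    using exists_leftmost_point[OF fin ne inj] by blast
  define S u where "S = V - {c}" and "u = (\<lambda>j. p j - p c)"
  have S: "finite S" "card S \<ge> 4" using fin card c by (auto simp: S_def)
  then have S_ne: "S \<noteq> {}" by auto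
  have half: "u j \<in> right_half_plane" if "j \<in> S" for j
    using c that by (simp add: S_def u_def)
  have n1: "cmod (u j) \<ge> 1" "(cmod (u j))\<^sup>2 \<le> 2" if "j \<in> S" for j
    using sep[of j c] le2[of j c] that c by (auto simp: S_def u_def dist_norm)
  \<comment> \<open>The rational bound 3/2 on \<open>sqrt 2\<close> keeps the difference of two lengths within 1/2.\<close>
  have n2: "cmod (u j) \<le> 3/2" if "j \<in> S" for j
  proof (rule power2_le_imp_le)
    show "(cmod (u j))\<^sup>2 \<le> (3/2)\<^sup>2" using n1(2)[OF that] by (simp add: power2_eq_square)
  qed simp
  have dot: "2 * (u j \<bullet> u k) = (cmod (u j))\<^sup>2 + (cmod (u k))\<^sup>2 - (dist (p j) (p k))\<^sup>2" for j k
  proof -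
    have "(dist (p j) (p k))\<^sup>2 = (cmod (u j - u k))\<^sup>2" by (simp add: u_def dist_norm)
    then show ?thesis
      by (simp add: power2_norm_eq_inner inner_diff_left inner_diff_right inner_commute)
  qed
  have sepu: "u j \<bullet> u k \<le> 4/5 * (cmod (u j) * cmod (u k))"
    if jk: "j \<in> S" "k \<in> S" "j \<noteq> k" for j k
  proof -
    have "dist (p j) (p k) \<ge> 1" using sep jk by (simp add: S_def)
    then have "(dist (p j) (p k))\<^sup>2 \<ge> 1" by simp
    then have 1: "2 * (u j \<bullet> u k) \<le> (cmod (u j))\<^sup>2 + (cmod (u k))\<^sup>2 - 1"
      unfolding dot by simp
    have "\<bar>cmod (u j) - cmod (u k)\<bar> \<le> 1/2"
      using n1[OF jk(1)] n1[OF jk(2)] n2[OF jk(1)] n2[OF jk(2)] by linarith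
    then have "(cmod (u j) - cmod (u k))\<^sup>2 \<le> (1/2)\<^sup>2"
      by (metis abs_ge_zero power2_abs power_mono)
    then have "4 * (cmod (u j) - cmod (u k))\<^sup>2 \<le> 1" by (simp add: power2_eq_square)
    then have "5 * ((cmod (u j))\<^sup>2 + (cmod (u k))\<^sup>2 - 1) \<le> 8 * (cmod (u j) * cmod (u k))"
      using n1(2)[OF jk(1)] n1(2)[OF jk(2)] by (simp add: power2_eq_square algebra_simps)
    moreover have "x \<le> 4/5 * P" if "5 * A \<le> 8 * P" "2 * x \<le> A" for x A P :: real
      using that by linarith
    ultimately show ?thesis using 1 by blast
  qed
  have "\<exists>i\<in>S. \<exists>j\<in>S. (real (card S) - 1) * arccos (4/5) \<le> Arg (u j) - Arg (u i)
      \<and> Arg (u j) - Arg (u i) < pi"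
    using half sepu by (intro angular_spread[OF S(1) S_ne]) auto
  then obtain i j where ij: "i \<in> S" "j \<in> S" "Arg (u j) - Arg (u i) \<ge> (real (card S) - 1) * arccos (4/5)"
    "Arg (u j) - Arg (u i) < pi"
    by blast
  \<comment> \<open>The cosine of \<open>\<pi>/6\<close> is \<open>sqrt 3 / 2\<close>, which exceeds 4/5.\<close>
  have "cos (pi/6) > (4/5::real)"
    unfolding cos_30 using real_less_rsqrt[of "8/5" 3] by (simp add: power2_eq_square)
  then have "arccos (4/5) > arccos (cos (pi / 6))"
    by (subst arccos_less_mono) auto
  then have "arccos (4/5) > pi / 6" by (simp add: arccos_cos)
  then have "3 * (pi / 6) < 3 * arccos (4/5)" by simp
  also have "\<dots> \<le> (real (card S) - 1) * arccos (4/5)"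
    using S(2) by (intro mult_right_mono arccos_lbound) auto
  finally have "Arg (u j) - Arg (u i) > pi / 2" using ij(3) by simp
  then have "cos (Arg (u j) - Arg (u i)) < 0"
    using ij(4) cos_lt_zero_pi by simp
  moreover have "cmod (u j) * cmod (u i) > 0"
    using half ij Arg_right_half_plane(3) by simp
  ultimately have "u j \<bullet> u i < 0"
    unfolding inner_eq_cos_Arg by (rule mult_pos_neg[rotated])
  moreover have "2 * (u j \<bullet> u i) \<ge> 0"
  proof -
    have "(cmod (u j))\<^sup>2 \<ge> 1" "(cmod (u i))\<^sup>2 \<ge> 1" using n1(1) ij by auto
    then show ?thesis unfolding dot using le2[of j i] ij by (simp add: S_def)
  qed
  ultimately show False by simp
qed

section \<open>Symmetric matrices with one negative eigenvalue\<close>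

lemma subspace_coord_space: "subspace (coord_space C :: (real ^ 'a::finite) set)"
  unfolding coord_space_def by (auto simp: subspace_def)

lemma dim_coord_space: "dim (coord_space C :: (real ^ 'a::finite) set) = card C"
  using dim_substandard_cart[where 'a = real and d = C] unfolding coord_space_def dim_vec_eq .

lemma inner_symmetric_matrix:
  fixes N :: "real ^ 'a ^ 'a::finite"
  assumes "transpose N = N"
  shows "x \<bullet> (N *v y) = (N *v x) \<bullet> y"
  by (metis assms dot_lmul_matrix transpose_matrix_vector)

lemma quadratic_form_add:
  fixes N :: "real ^ 'a ^ 'a::finite"
  assumes "transpose N = N"
  shows "(a *\<^sub>R x + b *\<^sub>R y) \<bullet> (N *v (a *\<^sub>R x + b *\<^sub>R y))
    = a\<^sup>2 * (x \<bullet> (N *v x)) + 2 * a * b * (x \<bullet> (N *v y)) + b\<^sup>2 * (y \<bullet> (N *v y))"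
proof -
  have "y \<bullet> (N *v x) = x \<bullet> (N *v y)"
    using inner_symmetric_matrix[OF assms, of x y] by (simp add: inner_commute)
  then show ?thesis
    by (simp add: matrix_vector_right_distrib matrix_vector_mult_scaleR inner_add_left inner_add_right
        power2_eq_square algebra_simps)
qed

lemma linear_coefficient_zero:
  fixes b c :: real
  assumes "\<And>s. 2 * s * b + s\<^sup>2 * c \<ge> 0"
  shows "b = 0"
proof (rule ccontr)
  assume b: "b \<noteq> 0"
  define k where "k = \<bar>c\<bar> + 1"
  have k: "k > 0" "c < k" by (auto simp: k_def)
  have "2 * (- b / k) * b + (- b / k)\<^sup>2 * c \<le> 2 * (- b / k) * b + (- b / k)\<^sup>2 * k"
    using k by (intro add_left_mono mult_left_mono) auto
  also have "\<dots> = - (b\<^sup>2 / k)" using k by (simp add: power2_eq_square field_simps)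
  also have "\<dots> < 0" using b k by simp
  finally show False using assms[of "- b / k"] by simp
qed

text \<open>The minimum of the quadratic form on the unit sphere of \<open>coord_space C\<close> is negative, and by
  first-order optimality it is attained at an eigenvector.\<close>

lemma negative_direction_eigenvalue:
  fixes N :: "real ^ 'a ^ 'a::finite"
  assumes sym: "transpose N = N"
    and supp: "\<And>i j. i \<notin> C \<Longrightarrow> N $ i $ j = 0"
    and z: "z \<in> coord_space C" "z \<bullet> (N *v z) < 0"
  shows "\<exists>t<0. eigenvalue C N t"
proof -
  let ?S = "coord_space C \<inter> sphere 0 1 :: (real ^ 'a) set"
  let ?q = "\<lambda>x. x \<bullet> (N *v x)"
  have sub: "subspace (coord_space C :: (real ^ 'a) set)" by (rule subspace_coord_space)
  have Nin: "N *v x \<in> coord_space C" for x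
    using supp by (simp add: coord_space_def matrix_vector_mult_def)
  have znz: "z \<noteq> 0" using z by auto
  have "compact ?S" using closed_subspace[OF sub] by (intro closed_Int_compact) auto
  moreover have "(1 / norm z) *\<^sub>R z \<in> ?S"
    using z(1) znz subspace_scale[OF sub] by simp
  moreover have "continuous_on ?S ?q" by (intro continuous_intros matrix_vector_mult_linear_continuous_on)
  ultimately obtain v where v: "v \<in> ?S" "\<And>x. x \<in> ?S \<Longrightarrow> ?q v \<le> ?q x"
    using continuous_attains_inf[of ?S ?q] by blast
  define t where "t = ?q v"
  have vv: "v \<bullet> v = 1" using v(1) by (simp add: norm_eq_1)
  have vC: "v \<in> coord_space C" using v(1) by simp
  have min: "t * (x \<bullet> x) \<le> ?q x" if "x \<in> coord_space C" for x
  proof (cases "x = 0")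
    case False
    have "(1 / norm x) *\<^sub>R x \<in> ?S"
      using that False subspace_scale[OF sub] by simp
    then have "t \<le> ?q ((1 / norm x) *\<^sub>R x)" unfolding t_def by (rule v(2))
    also have "\<dots> = ?q x / (x \<bullet> x)"
      unfolding matrix_vector_mult_scaleR
      by (simp add: power2_norm_eq_inner[symmetric] power2_eq_square)
    finally show ?thesis using False by (simp add: pos_le_divide_eq)
  qed simp
  have "t * (z \<bullet> z) < 0" using min[OF z(1)] z(2) by linarith
  then have t: "t < 0" using inner_ge_zero[of z] by (smt (verit) mult_nonneg_nonneg)
  define y where "y = N *v v - t *\<^sub>R v"
  have yC: "y \<in> coord_space C"
    unfolding y_def by (intro subspace_diff[OF sub] subspace_scale[OF sub] Nin vC)
  have yv: "v \<bullet> y = 0" by (simp add: y_def inner_diff_right vv t_def)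
  \<comment> \<open>Move the minimiser \<open>v\<close> in the direction of its own residual \<open>y\<close>.\<close>
  have "2 * s * (v \<bullet> (N *v y)) + s\<^sup>2 * (?q y - t * (y \<bullet> y)) \<ge> 0" for s
  proof -
    have "v + s *\<^sub>R y \<in> coord_space C"
      by (intro subspace_add[OF sub] subspace_scale[OF sub] vC yC)
    then have le: "t * ((v + s *\<^sub>R y) \<bullet> (v + s *\<^sub>R y)) \<le> ?q (v + s *\<^sub>R y)" by (rule min)
    have e1: "?q (v + s *\<^sub>R y) = t + 2 * s * (v \<bullet> (N *v y)) + s\<^sup>2 * ?q y"
      using quadratic_form_add[OF sym, of 1 v s y] by (simp add: t_def)
    have e2: "(v + s *\<^sub>R y) \<bullet> (v + s *\<^sub>R y) = 1 + s\<^sup>2 * (y \<bullet> y)"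
      using vv yv by (simp add: inner_add_left inner_add_right inner_commute power2_eq_square)
    have "t * (1 + s\<^sup>2 * (y \<bullet> y)) \<le> t + 2 * s * (v \<bullet> (N *v y)) + s\<^sup>2 * ?q y"
      using le unfolding e1 e2 .
    then show ?thesis by (simp add: algebra_simps)
  qed
  then have "v \<bullet> (N *v y) = 0" by (rule linear_coefficient_zero)
  then have "(N *v v) \<bullet> y = 0" using inner_symmetric_matrix[OF sym] by simp
  then have "y \<bullet> y = 0" using yv by (simp add: y_def inner_diff_left inner_commute)
  then have "N *v v = t *\<^sub>R v" by (simp add: y_def)
  moreover have "v \<noteq> 0" using vv by auto
  ultimately have "eigenvalue C N t" using vC by (auto simp: eigenvalue_def eigenspace_def)
  with t show ?thesis by blast
qed

text \<open>Two independent eigenvectors with negative eigenvalues span a plane on which the form is negative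
  definite, and every plane contains a nonzero vector orthogonal to \<open>w\<close>, where the form is nonnegative.\<close>

lemma one_negative_eigenvalue:
  fixes N :: "real ^ 'a ^ 'a::finite"
  assumes sym: "transpose N = N"
    and supp: "\<And>i j. i \<notin> C \<Longrightarrow> N $ i $ j = 0"
    and z: "z \<in> coord_space C" "z \<bullet> (N *v z) < 0"
    and psd: "\<And>x. x \<in> coord_space C \<Longrightarrow> w \<bullet> x = 0 \<Longrightarrow> x \<bullet> (N *v x) \<ge> 0"
  shows "num_negative_eigenvalues C N = 1"
proof -
  have sub: "subspace (coord_space C :: (real ^ 'a) set)" by (rule subspace_coord_space)
  have wnz: "w \<bullet> x \<noteq> 0" if "x \<in> eigenspace C N t" "t < 0" "x \<noteq> 0" for x t
  proof
    assume "w \<bullet> x = 0"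
    with psd[of x] that have "t * (x \<bullet> x) \<ge> 0" by (simp add: eigenspace_def)
    moreover have "t * (x \<bullet> x) < 0" using that by (intro mult_neg_pos) auto
    ultimately show False by simp
  qed
  obtain t where t: "t < 0" "eigenvalue C N t"
    using negative_direction_eigenvalue[OF sym supp z] by blast
  then obtain v where v: "v \<in> eigenspace C N t" "v \<noteq> 0" by (auto simp: eigenvalue_def)
  have unique: "s = t" if s: "s < 0" "eigenvalue C N s" for s
  proof (rule ccontr)
    assume st: "s \<noteq> t"
    from s obtain x where x: "x \<in> eigenspace C N s" "x \<noteq> 0" by (auto simp: eigenvalue_def)
    have Nx: "N *v x = s *\<^sub>R x" and Nv: "N *v v = t *\<^sub>R v"
      using x v by (auto simp: eigenspace_def)
    have "x \<bullet> (N *v v) = (N *v x) \<bullet> v" by (rule inner_symmetric_matrix[OF sym])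
    then have xv: "x \<bullet> v = 0" using st by (simp add: Nx Nv)
    define y where "y = (w \<bullet> v) *\<^sub>R x + (- (w \<bullet> x)) *\<^sub>R v"
    have "y \<in> coord_space C"
      unfolding y_def using x v
      by (intro subspace_add[OF sub] subspace_scale[OF sub]) (auto simp: eigenspace_def)
    moreover have "w \<bullet> y = 0" by (simp add: y_def inner_diff_right)
    ultimately have "y \<bullet> (N *v y) \<ge> 0" by (rule psd)
    moreover have "y \<bullet> (N *v y) = (w \<bullet> v)\<^sup>2 * (s * (x \<bullet> x)) + (w \<bullet> x)\<^sup>2 * (t * (v \<bullet> v))"
      unfolding y_def quadratic_form_add[OF sym] by (simp add: Nx Nv xv)
    moreover have "(w \<bullet> v)\<^sup>2 * (s * (x \<bullet> x)) < 0" "(w \<bullet> x)\<^sup>2 * (t * (v \<bullet> v)) < 0"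
      using wnz[OF x(1) s(1) x(2)] wnz[OF v(1) t(1) v(2)] s(1) t(1) x(2) v(2)
      by (simp_all add: mult_less_0_iff)
    ultimately show False by linarith
  qed
  have "eigenspace C N t = span {v}"
  proof (rule subset_antisym)
    show "span {v} \<subseteq> eigenspace C N t"
      using v(1) subspace_scale[OF sub, of v]
      by (auto simp: span_singleton eigenspace_def matrix_vector_mult_scaleR)
    show "eigenspace C N t \<subseteq> span {v}"
    proof
      fix x assume x: "x \<in> eigenspace C N t"
      define y where "y = x - ((w \<bullet> x) / (w \<bullet> v)) *\<^sub>R v"
      have "y \<in> eigenspace C N t"
        using x v(1) subspace_diff[OF sub] subspace_scale[OF sub]
        by (auto simp: y_def eigenspace_def matrix_vector_mult_diff_distrib
            matrix_vector_mult_scaleR algebra_simps)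
      moreover have "w \<bullet> y = 0"
        using wnz[OF v(1) t(1) v(2)] by (simp add: y_def inner_diff_right)
      ultimately have "y = 0" using wnz t(1) by blast
      then show "x \<in> span {v}" by (auto simp: y_def span_singleton)
    qed
  qed
  then have "dim (eigenspace C N t) = 1" using v(2) by (simp add: dim_eq_card_independent)
  moreover have "{s. s < 0 \<and> eigenvalue C N s} = {t}" using t unique by blast
  ultimately show ?thesis by (simp add: num_negative_eigenvalues_def)
qed

lemma dim_orthogonal_ge:
  fixes W :: "(real ^ 'a::finite) set"
  assumes "W \<subseteq> coord_space V" "finite W" "card W \<le> m"
  shows "dim {x \<in> coord_space V. \<forall>w\<in>W. w \<bullet> x = 0} \<ge> card V - m"
proof -
  have sub: "subspace (coord_space V :: (real ^ 'a) set)" by (rule subspace_coord_space)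
  have "dim {y \<in> coord_space V. \<forall>x\<in>span W. orthogonal x y} + dim (span W) = card V"
    using dim_subspace_orthogonal_to_vectors[OF subspace_span sub span_minimal[OF assms(1) sub]]
    by (simp add: dim_coord_space)
  moreover have "dim (span W) \<le> m" using dim_le_card'[OF assms(2)] assms(3) by simp
  moreover have "(\<forall>x\<in>span W. orthogonal x y) \<longleftrightarrow> (\<forall>w\<in>W. w \<bullet> y = 0)" for y
    using orthogonal_to_span[of _ W y] span_base[of _ W]
    by (metis orthogonal_commute orthogonal_def)
  ultimately show ?thesis by simp
qed

section \<open>The disk matrix\<close>

text \<open>This is the principal submatrix on \<open>C\<close> of \<open>J - D\<close>, where \<open>J\<close> is the all-ones matrix and \<open>D\<close> the
  Euclidean distance matrix of the points. Its diagonal entries are 1, its entries are 0 for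
  touching disks and negative for disjoint ones.\<close>

definition disk_matrix :: "('a \<Rightarrow> complex) \<Rightarrow> 'a set \<Rightarrow> real ^ 'a ^ 'a::finite" where
  "disk_matrix p C = (\<chi> i j. if i \<in> C \<and> j \<in> C then 1 - (dist (p i) (p j))\<^sup>2 else 0)"

lemma transpose_disk_matrix: "transpose (disk_matrix p C) = disk_matrix p C"
  by (simp add: transpose_def disk_matrix_def vec_eq_iff dist_commute)

lemma sum_coord_space:
  fixes x :: "real ^ 'a::finite" and f :: "'a \<Rightarrow> real \<Rightarrow> 'b::comm_monoid_add"
  assumes "x \<in> coord_space C" "\<And>i. f i 0 = 0"
  shows "(\<Sum>i\<in>UNIV. f i (x $ i)) = (\<Sum>i\<in>C. f i (x $ i))"
  using assms by (intro sum.mono_neutral_right) (auto simp: coord_space_def)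

lemma disk_matrix_mult_nth:
  fixes x :: "real ^ 'a::finite"
  shows "(disk_matrix p C *v x) $ i = (if i \<in> C then \<Sum>j\<in>C. (1 - (dist (p i) (p j))\<^sup>2) * x $ j else 0)"
proof (cases "i \<in> C")
  case True
  have "(disk_matrix p C *v x) $ i
      = (\<Sum>j\<in>UNIV. if j \<in> C then (1 - (dist (p i) (p j))\<^sup>2) * x $ j else 0)"
    using True by (auto simp: matrix_vector_mult_def disk_matrix_def intro!: sum.cong)
  then show ?thesis using True by (simp add: sum.If_cases)
qed (simp add: matrix_vector_mult_def disk_matrix_def)

lemma disk_matrix_form:
  fixes x y :: "real ^ 'a::finite"
  shows "x \<bullet> (disk_matrix p C *v y)
    = (\<Sum>i\<in>C. \<Sum>j\<in>C. (1 - (dist (p i) (p j))\<^sup>2) * (x $ i * y $ j))"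
proof -
  have "x \<bullet> (disk_matrix p C *v y)
      = (\<Sum>i\<in>UNIV. if i \<in> C then x $ i * (\<Sum>j\<in>C. (1 - (dist (p i) (p j))\<^sup>2) * y $ j) else 0)"
    unfolding inner_vec_def disk_matrix_mult_nth by (auto intro!: sum.cong)
  also have "\<dots> = (\<Sum>i\<in>C. x $ i * (\<Sum>j\<in>C. (1 - (dist (p i) (p j))\<^sup>2) * y $ j))"
    by (simp add: sum.If_cases)
  also have "\<dots> = (\<Sum>i\<in>C. \<Sum>j\<in>C. (1 - (dist (p i) (p j))\<^sup>2) * (x $ i * y $ j))"
    by (simp add: sum_distrib_left mult_ac)
  finally show ?thesis .
qed

lemma dist_sq_expand:
  fixes a b :: complex
  shows "1 - (dist a b)\<^sup>2 = 1 - (cmod a)\<^sup>2 - (cmod b)\<^sup>2 + 2 * (a \<bullet> b)"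
  by (simp add: dist_norm power2_norm_eq_inner inner_diff_left inner_diff_right inner_commute)

lemma disk_matrix_row:
  fixes x :: "real ^ 'a::finite"
  assumes s0: "(\<Sum>j\<in>C. x $ j) = 0"
  shows "(\<Sum>j\<in>C. (1 - (dist (p i) (p j))\<^sup>2) * x $ j)
    = 2 * (p i \<bullet> (\<Sum>j\<in>C. x $ j *\<^sub>R p j)) - (\<Sum>j\<in>C. x $ j * (cmod (p j))\<^sup>2)"
proof -
  have "(\<Sum>j\<in>C. (1 - (dist (p i) (p j))\<^sup>2) * x $ j)
      = (\<Sum>j\<in>C. (1 - (cmod (p i))\<^sup>2) * x $ j - x $ j * (cmod (p j))\<^sup>2 + 2 * (x $ j * (p i \<bullet> p j)))"
    unfolding dist_sq_expand by (intro sum.cong refl) (simp add: algebra_simps)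
  also have "\<dots> = (1 - (cmod (p i))\<^sup>2) * (\<Sum>j\<in>C. x $ j) - (\<Sum>j\<in>C. x $ j * (cmod (p j))\<^sup>2)
      + 2 * (\<Sum>j\<in>C. x $ j * (p i \<bullet> p j))"
    by (simp add: sum.distrib sum_subtractf sum_distrib_left)
  also have "(\<Sum>j\<in>C. x $ j * (p i \<bullet> p j)) = p i \<bullet> (\<Sum>j\<in>C. x $ j *\<^sub>R p j)"
    by (simp add: inner_sum_right)
  finally show ?thesis using s0 by simp
qed

text \<open>On vectors with coordinate sum 0 the all-ones part and the squared norms in \<open>1 - |p i - p j|^2\<close>
  cancel, and only the Gram matrix of the points remains.\<close>

lemma disk_matrix_form_on_balanced:
  fixes x :: "real ^ 'a::finite"
  assumes s0: "(\<Sum>j\<in>C. x $ j) = 0"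
  shows "x \<bullet> (disk_matrix p C *v x) = 2 * (cmod (\<Sum>j\<in>C. x $ j *\<^sub>R p j))\<^sup>2"
proof -
  define P Q where "P = (\<Sum>j\<in>C. x $ j *\<^sub>R p j)" and "Q = (\<Sum>j\<in>C. x $ j * (cmod (p j))\<^sup>2)"
  have "x \<bullet> (disk_matrix p C *v x)
      = (\<Sum>i\<in>C. x $ i * (\<Sum>j\<in>C. (1 - (dist (p i) (p j))\<^sup>2) * x $ j))"
    unfolding disk_matrix_form by (simp add: sum_distrib_left mult_ac)
  also have "\<dots> = (\<Sum>i\<in>C. x $ i * (2 * (p i \<bullet> P) - Q))"
    unfolding disk_matrix_row[OF s0] P_def Q_def ..
  also have "\<dots> = (\<Sum>i\<in>C. 2 * ((x $ i *\<^sub>R p i) \<bullet> P) - x $ i * Q)"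
    by (simp add: algebra_simps)
  also have "\<dots> = 2 * (P \<bullet> P) - (\<Sum>i\<in>C. x $ i) * Q"
    unfolding P_def by (simp add: sum_subtractf sum_distrib_left sum_distrib_right inner_sum_left)
  finally show ?thesis using s0 by (simp add: P_def power2_norm_eq_inner)
qed

lemma mem_compl_edges_iff:
  "{u, v} \<in> compl_edges A D \<longleftrightarrow> u \<in> A \<and> v \<in> A \<and> u \<noteq> v \<and> {u, v} \<notin> D"
  by (auto simp: compl_edges_def doubleton_eq_iff insert_commute)

locale separated_points =
  fixes V :: "'a::finite set" and p :: "'a \<Rightarrow> complex"
  assumes sep: "\<And>i j. i \<in> V \<Longrightarrow> j \<in> V \<Longrightarrow> i \<noteq> j \<Longrightarrow> dist (p i) (p j) \<ge> 1"
begin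

abbreviation M :: "real ^ 'a ^ 'a" where "M \<equiv> disk_matrix p V"

lemma inj_p: "inj_on p V"
  using sep by (force simp: inj_on_def)

text \<open>A kernel vector with nonzero coordinate sum could be added to any vector to make its sum 0 without
  changing the value of the form. The form would then be nonnegative everywhere, although \<open>z\<close>
  makes it negative.\<close>

lemma kernel_balanced:
  assumes z: "z \<in> coord_space V" "z \<bullet> (M *v z) < 0"
    and x: "x \<in> coord_space V" "M *v x = 0"
  shows "(\<Sum>i\<in>V. x $ i) = 0" "(\<Sum>i\<in>V. x $ i *\<^sub>R p i) = 0"
proof -
  show s0: "(\<Sum>i\<in>V. x $ i) = 0"
  proof (rule ccontr)
    assume ne: "(\<Sum>i\<in>V. x $ i) \<noteq> 0"
    define y where "y = 1 *\<^sub>R z + (- (\<Sum>i\<in>V. z $ i) / (\<Sum>i\<in>V. x $ i)) *\<^sub>R x"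
    have "(\<Sum>i\<in>V. y $ i) = 0"
      using ne by (simp add: y_def sum_subtractf flip: sum_divide_distrib sum_distrib_left)
    then have "y \<bullet> (M *v y) \<ge> 0" by (simp add: disk_matrix_form_on_balanced)
    moreover have "z \<bullet> (M *v x) = 0" using x by simp
    then have "y \<bullet> (M *v y) = z \<bullet> (M *v z)"
      unfolding y_def quadratic_form_add[OF transpose_disk_matrix] using x by simp
    ultimately show False using z by simp
  qed
  show "(\<Sum>i\<in>V. x $ i *\<^sub>R p i) = 0"
    using disk_matrix_form_on_balanced[OF s0, of p] x by simp
qed

lemma disk_matrix_abs_le:
  fixes x :: "real ^ 'a"
  shows "(\<chi> i. \<bar>x $ i\<bar>) \<bullet> (M *v (\<chi> i. \<bar>x $ i\<bar>)) \<le> x \<bullet> (M *v x)"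
  unfolding disk_matrix_form
proof (intro sum_mono)
  fix i j assume ij: "i \<in> V" "j \<in> V"
  show "(1 - (dist (p i) (p j))\<^sup>2) * ((\<chi> i. \<bar>x $ i\<bar>) $ i * (\<chi> i. \<bar>x $ i\<bar>) $ j)
      \<le> (1 - (dist (p i) (p j))\<^sup>2) * (x $ i * x $ j)"
  proof (cases "i = j")
    case False
    then have "(dist (p i) (p j))\<^sup>2 \<ge> 1" using sep ij by simp
    moreover have "x $ i * x $ j \<le> \<bar>x $ i\<bar> * \<bar>x $ j\<bar>"
      by (metis abs_ge_self abs_mult)
    ultimately show ?thesis by (simp add: mult_left_mono_neg)
  qed simp
qed

text \<open>The Perron-Frobenius idea: since off-diagonal entries are nonpositive, replacing a vector by its
  absolute values does not increase the form. If a kernel vector had a nonzero part outside the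
  block \<open>C\<close>, then the absolute values \<open>a\<close> of that part and \<open>b\<close> of \<open>z\<close> would be nonnegative vectors in
  different blocks, and the combination of them with coordinate sum 0 would have a negative value.
  So when the complement graph is disconnected, a single component carries the whole corank.\<close>

lemma kernel_in_negative_block:
  assumes C: "C \<subseteq> V" and block: "\<And>i j. i \<in> C \<Longrightarrow> j \<in> V - C \<Longrightarrow> dist (p i) (p j) = 1"
    and z: "z \<in> coord_space C" "z \<bullet> (M *v z) < 0"
    and x: "x \<in> coord_space V" "M *v x = 0"
  shows "x \<in> coord_space C"
proof -
  define y :: "real ^ 'a" where "y = (\<chi> i. if i \<in> V - C then x $ i else 0)"
  define a :: "real ^ 'a" where "a = (\<chi> i. \<bar>y $ i\<bar>)"
  define b :: "real ^ 'a" where "b = (\<chi> i. \<bar>z $ i\<bar>)"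
  have ker: "y \<bullet> (M *v y) = y \<bullet> (M *v x)"
    unfolding disk_matrix_form
  proof (intro sum.cong refl)
    fix i j assume "i \<in> V" "j \<in> V"
    then show "(1 - (dist (p i) (p j))\<^sup>2) * (y $ i * y $ j)
        = (1 - (dist (p i) (p j))\<^sup>2) * (y $ i * x $ j)"
      using block[of j i] by (auto simp: y_def dist_commute)
  qed
  have aa: "a \<bullet> (M *v a) \<le> 0"
    using disk_matrix_abs_le[of y] ker x by (simp add: a_def)
  have bb: "b \<bullet> (M *v b) < 0"
    using disk_matrix_abs_le[of z] z by (simp add: b_def)
  have ab: "a \<bullet> (M *v b) = 0"
    unfolding disk_matrix_form
  proof (intro sum.neutral ballI)
    fix i j assume "i \<in> V" "j \<in> V"
    then show "(1 - (dist (p i) (p j))\<^sup>2) * (a $ i * b $ j) = 0"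
      using block[of j i] z(1)
      by (cases "i \<in> C"; cases "j \<in> C") (auto simp: a_def b_def y_def coord_space_def dist_commute)
  qed
  define u where "u = (\<Sum>i\<in>V. b $ i) *\<^sub>R a + (- (\<Sum>i\<in>V. a $ i)) *\<^sub>R b"
  have "(\<Sum>i\<in>V. u $ i) = 0"
    by (simp add: u_def sum_subtractf flip: sum_distrib_left)
  then have "u \<bullet> (M *v u) \<ge> 0" by (simp add: disk_matrix_form_on_balanced)
  then have "(\<Sum>i\<in>V. b $ i)\<^sup>2 * (a \<bullet> (M *v a)) + (\<Sum>i\<in>V. a $ i)\<^sup>2 * (b \<bullet> (M *v b)) \<ge> 0"
    unfolding u_def quadratic_form_add[OF transpose_disk_matrix] ab by simp
  moreover have "(\<Sum>i\<in>V. b $ i)\<^sup>2 * (a \<bullet> (M *v a)) \<le> 0"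
    using aa by (simp add: mult_nonneg_nonpos)
  ultimately have "(\<Sum>i\<in>V. a $ i)\<^sup>2 * (b \<bullet> (M *v b)) \<ge> 0" by linarith
  then have "(\<Sum>i\<in>V. a $ i) = 0" using bb by (auto simp: zero_le_mult_iff)
  then have y0: "y $ i = 0" if "i \<in> V" for i
    using that by (subst (asm) sum_nonneg_eq_0_iff) (auto simp: a_def)
  have "x $ i = 0" if "i \<in> V - C" for i
    using y0[of i] that by (simp add: y_def)
  then show ?thesis using x(1) by (auto simp: coord_space_def)
qed

text \<open>Such an \<open>X\<close> is an equilibrium stress of the contact graph whose coefficients at each node also sum
  to 0. The leftmost node that carries stress has at most three stressed neighbours, all in a
  half-plane and on the unit circle around it; they are affinely independent, so their
  coefficients vanish.\<close>

lemma no_contact_stress: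
  fixes X :: "'a \<Rightarrow> 'a \<Rightarrow> real"
  assumes sym: "\<And>i j. X i j = X j i"
    and contact: "\<And>i j. X i j \<noteq> 0 \<Longrightarrow> i \<in> V \<and> j \<in> V \<and> dist (p i) (p j) = 1"
    and sum0: "\<And>j. (\<Sum>i\<in>V. X i j) = 0"
    and sum1: "\<And>j. (\<Sum>i\<in>V. X i j *\<^sub>R p i) = 0"
  shows "X i j = 0"
proof (rule ccontr)
  assume nz: "X i j \<noteq> 0"
  define T where "T = {k. \<exists>l. X k l \<noteq> 0}"
  have T: "T \<subseteq> V" "T \<noteq> {}" using nz contact by (auto simp: T_def)
  obtain k where k: "k \<in> T" "\<And>l. l \<in> T \<Longrightarrow> l \<noteq> k \<Longrightarrow> p l - p k \<in> right_half_plane"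
    using exists_leftmost_point[of T p] T inj_on_subset[OF inj_p T(1)] by (metis finite)
  define S u where "S = {l. X l k \<noteq> 0}" and "u = (\<lambda>l. p l - p k)"
  have SV: "S \<subseteq> V" using contact by (auto simp: S_def)
  have half: "u l \<in> right_half_plane" if "l \<in> S" for l
  proof -
    have "l \<in> T" "dist (p l) (p k) = 1" using that contact by (auto simp: S_def T_def)
    moreover from this have "l \<noteq> k" by auto
    ultimately show ?thesis using k(2)[of l] by (auto simp: u_def)
  qed
  have unit: "cmod (u l) = 1" if "l \<in> S" for l
    using contact[of l k] that by (simp add: S_def u_def dist_norm)
  have "dist (u l) (u m) \<ge> 1" if "l \<in> S" "m \<in> S" "l \<noteq> m" for l m
    using sep[of l m] that SV by (auto simp: u_def dist_norm)
  then have card: "card S \<le> 3" using half unit by (intro at_most_three_unit_neighbours[of S u]) auto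
  have inj: "inj_on u S"
    using inj_on_subset[OF inj_p SV] by (auto simp: inj_on_def u_def)
  have restrict: "(\<Sum>l\<in>V. f l) = (\<Sum>l\<in>S. f l)" if "\<And>l. X l k = 0 \<Longrightarrow> f l = 0"
    for f :: "'a \<Rightarrow> 'b::comm_monoid_add"
    using that SV by (intro sum.mono_neutral_right) (auto simp: S_def)
  have "(\<Sum>l\<in>S. X l k) = 0" using sum0[of k] restrict[of "\<lambda>l. X l k"] by simp
  moreover have "(\<Sum>l\<in>S. X l k *\<^sub>R u l) = 0"
    using sum1[of k] restrict[of "\<lambda>l. X l k *\<^sub>R p l"] calculation
    by (simp add: u_def scaleR_diff_right sum_subtractf flip: scaleR_sum_left)
  moreover obtain l where "X k l \<noteq> 0" using k(1) by (auto simp: T_def)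
  then have "l \<in> S" "X l k \<noteq> 0" using sym by (auto simp: S_def)
  ultimately show False
    using affinely_independent_on_circle[of S u "\<lambda>l. X l k" l] card inj unit by auto
qed

lemma block_matrix_mult:
  assumes C: "C \<subseteq> V" and block: "\<And>i j. i \<in> C \<Longrightarrow> j \<in> V - C \<Longrightarrow> dist (p i) (p j) = 1"
    and x: "x \<in> coord_space C"
  shows "disk_matrix p C *v x = M *v x"
proof -
  have x0: "x $ j = 0" if "j \<notin> C" for j using x that by (simp add: coord_space_def)
  have "(disk_matrix p C *v x) $ i = (M *v x) $ i" for i
  proof (cases "i \<in> C")
    case True
    then have "(\<Sum>j\<in>C. (1 - (dist (p i) (p j))\<^sup>2) * x $ j) = (\<Sum>j\<in>V. (1 - (dist (p i) (p j))\<^sup>2) * x $ j)"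
      using C x0 by (intro sum.mono_neutral_left) auto
    then show ?thesis using True C by (auto simp: disk_matrix_mult_nth)
  next
    case False
    have "(1 - (dist (p i) (p j))\<^sup>2) * x $ j = 0" if "i \<in> V" "j \<in> V" for j
      using block[of j i] x0[of j] False that by (cases "j \<in> C") (auto simp: dist_commute)
    then have "(\<Sum>j\<in>V. (1 - (dist (p i) (p j))\<^sup>2) * x $ j) = 0" if "i \<in> V"
      using that by (intro sum.neutral) blast
    then show ?thesis using False by (simp add: disk_matrix_mult_nth)
  qed
  then show ?thesis by (simp add: vec_eq_iff)
qed

text \<open>The columns of a matrix \<open>X\<close> that violates (M3) lie in the kernel, so they have coordinate sum 0 and
  annihilate the points; as \<open>X\<close> is supported on touching pairs, it is a stress and vanishes.\<close>

lemma colin_de_verdiere_disk_matrix: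
  assumes contact: "\<And>i j. i \<in> V \<Longrightarrow> j \<in> V \<Longrightarrow> i \<noteq> j \<Longrightarrow> {i, j} \<in> E \<longleftrightarrow> dist (p i) (p j) = 1"
    and C: "C \<subseteq> V" and block: "\<And>i j. i \<in> C \<Longrightarrow> j \<in> V - C \<Longrightarrow> dist (p i) (p j) = 1"
    and z: "z \<in> coord_space C" "z \<bullet> (M *v z) < 0"
  shows "colin_de_verdiere_matrix C (induced_edges (compl_edges V E) C) (disk_matrix p C)"
proof -
  let ?F = "induced_edges (compl_edges V E) C"
  let ?N = "disk_matrix p C"
  have CV: "coord_space C \<subseteq> (coord_space V :: (real ^ 'a) set)"
    using C by (auto simp: coord_space_def)
  have mult: "?N *v x = M *v x" if "x \<in> coord_space C" for x
    by (rule block_matrix_mult[OF C block that])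
  have F: "{i, j} \<in> ?F \<longleftrightarrow> dist (p i) (p j) \<noteq> 1" if "i \<in> C" "j \<in> C" "i \<noteq> j" for i j
  proof -
    have "{i, j} \<in> ?F \<longleftrightarrow> {i, j} \<notin> E"
      using that C by (auto simp: induced_edges_def mem_compl_edges_iff)
    then show ?thesis using contact that C by blast
  qed
  have gm: "graph_matrix C ?F ?N"
    unfolding graph_matrix_def
  proof (intro conjI allI impI)
    fix i j assume "{i, j} \<in> compl_edges C ?F"
    then have "dist (p i) (p j) = 1" using F[of i j] by (simp add: mem_compl_edges_iff)
    then show "?N $ i $ j = 0" by (simp add: disk_matrix_def)
  next
    show "transpose ?N = ?N" by (rule transpose_disk_matrix)
  qed (auto simp: disk_matrix_def)
  have ws: "well_signed ?F ?N"
    unfolding well_signed_def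
  proof (intro allI impI, elim conjE)
    fix i j assume ij: "{i, j} \<in> ?F" "i \<noteq> j"
    then have ijC: "i \<in> C" "j \<in> C" by (auto simp: induced_edges_def)
    then have "dist (p i) (p j) > 1" using F ij sep C by (metis order_le_less subsetD)
    then have "(dist (p i) (p j))\<^sup>2 > 1" by simp
    then show "?N $ i $ j < 0" using ijC by (simp add: disk_matrix_def)
  qed
  have neg: "num_negative_eigenvalues C ?N = 1"
  proof (rule one_negative_eigenvalue[where w = "\<chi> i. 1"])
    show "transpose ?N = ?N" by (rule transpose_disk_matrix)
    show "?N $ i $ j = 0" if "i \<notin> C" for i j using that by (simp add: disk_matrix_def)
    show "z \<in> coord_space C" by (rule z)
    show "z \<bullet> (?N *v z) < 0" using z mult by simp
    show "x \<bullet> (?N *v x) \<ge> 0" if "x \<in> coord_space C" "(\<chi> i. 1) \<bullet> x = 0" for x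
    proof -
      have "(\<Sum>i\<in>C. x $ i) = 0"
        using that sum_coord_space[of x C "\<lambda>i t. t"] by (simp add: inner_vec_def)
      then show ?thesis by (simp add: disk_matrix_form_on_balanced)
    qed
  qed
  have "X = 0" if X: "graph_matrix C (compl_edges C ?F) X" "\<forall>i\<in>C. X $ i $ i = 0" "?N ** X = 0" for X
  proof -
    have X0: "X $ i $ j = 0" if "i \<notin> C \<or> j \<notin> C" for i j
      using X(1) that by (auto simp: graph_matrix_def)
    have sym: "X $ i $ j = X $ j $ i" for i j
      using X(1) unfolding graph_matrix_def transpose_def by (metis vec_lambda_beta)
    have contactX: "i \<in> V \<and> j \<in> V \<and> dist (p i) (p j) = 1" if nz: "X $ i $ j \<noteq> 0" for i j
    proof -
      have ij: "i \<in> C" "j \<in> C" "i \<noteq> j" using X0 X(2) nz by blast+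
      have "{i, j} \<notin> compl_edges C (compl_edges C ?F)"
        using X(1) nz by (auto simp: graph_matrix_def)
      then have "{i, j} \<notin> ?F" using ij by (simp add: mem_compl_edges_iff)
      then show ?thesis using F ij C by blast
    qed
    have col: "(\<Sum>i\<in>V. X $ i $ j) = 0 \<and> (\<Sum>i\<in>V. X $ i $ j *\<^sub>R p i) = 0" for j
    proof -
      define x where "x = column j X"
      have xC: "x \<in> coord_space C" using X0 by (simp add: x_def column_def coord_space_def)
      have "(?N *v x) $ i = (?N ** X) $ i $ j" for i
        by (simp add: matrix_vector_mult_def matrix_matrix_mult_def x_def column_def)
      then have "?N *v x = 0" using X(3) by (simp add: vec_eq_iff)
      then have "M *v x = 0" using mult[OF xC] by simp
      then have "(\<Sum>i\<in>V. x $ i) = 0" "(\<Sum>i\<in>V. x $ i *\<^sub>R p i) = 0"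
        using kernel_balanced[of z x] z CV xC by auto
      then show ?thesis by (simp add: x_def column_def)
    qed
    have "X $ i $ j = 0" for i j
      using no_contact_stress[of "\<lambda>i j. X $ i $ j"] sym contactX col by blast
    then show "X = 0" by (simp add: vec_eq_iff)
  qed
  then show ?thesis
    unfolding colin_de_verdiere_matrix_def using gm ws neg by blast
qed

end

lemma mu_connected_ge_corank:
  assumes "colin_de_verdiere_matrix V E M"
  shows "corank V M \<le> mu_connected V E"
  unfolding mu_connected_def
proof (rule Max_ge)
  have "corank V N \<le> CARD('a)" for N :: "real ^ 'a ^ 'a"
    using dim_subset_UNIV[of "{x \<in> coord_space V. N *v x = 0}"] by (simp add: corank_def)
  then have "{corank V M |M. colin_de_verdiere_matrix V E M} \<subseteq> {..CARD('a)}" by blast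
  then show "finite {corank V M |M. colin_de_verdiere_matrix V E M}"
    by (rule finite_subset) simp
qed (use assms in blast)

lemma mu_ge_component:
  assumes F: "F \<noteq> {}" "\<Union>F \<subseteq> V" and C: "C \<in> components_of V F"
  shows "mu_connected C (induced_edges F C) \<le> mu V F"
proof (cases "connected_graph V F")
  case True
  then have "C = V" using C by (auto simp: components_of_def connected_graph_def)
  moreover have "induced_edges F V = F" using F by (auto simp: induced_edges_def)
  ultimately show ?thesis using F(1) True by (simp add: mu_def)
next
  case False
  have "{mu_connected C (induced_edges F C) |C. C \<in> components_of V F}
      = (\<lambda>C. mu_connected C (induced_edges F C)) ` components_of V F" by blast
  then have "mu_connected C (induced_edges F C)
      \<le> Max {mu_connected C (induced_edges F C) |C. C \<in> components_of V F}"
    using C by (intro Max_ge) auto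
  then show ?thesis using F(1) False by (simp add: mu_def)
qed

lemma axis_form:
  fixes N :: "real ^ 'a ^ 'a::finite"
  shows "axis i 1 \<bullet> (N *v axis j 1) = N $ i $ j"
  by (simp add: matrix_vector_mult_basis column_def inner_axis')

text \<open>These are the affine dependencies of the points lifted to the paraboloid by \<open>z \<mapsto> (z, |z|^2)\<close>. By the
  expansion of \<open>1 - |p i - p j|^2\<close> they lie in the kernel of the disk matrix.\<close>

definition lifted_dependencies :: "('a \<Rightarrow> complex) \<Rightarrow> 'a set \<Rightarrow> (real ^ 'a::finite) set" where
  "lifted_dependencies p V = {x \<in> coord_space V. (\<Sum>i\<in>V. x $ i) = 0 \<and> (\<Sum>i\<in>V. x $ i *\<^sub>R p i) = 0
     \<and> (\<Sum>i\<in>V. x $ i * (cmod (p i))\<^sup>2) = 0}"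

text \<open>The set \<open>C\<close> is the component of the complement graph that contains a pair at squared distance more
  than 2; it is the whole node set if the complement graph is connected. The sum of the two unit
  vectors of this pair is a negative direction, as \<open>1 + 1 + 2 (1 - |p a - p b|^2) < 0\<close>.\<close>

lemma (in separated_points) mu_ge_dim_lifted_dependencies:
  assumes contact: "\<And>i j. i \<in> V \<Longrightarrow> j \<in> V \<Longrightarrow> i \<noteq> j \<Longrightarrow> {i, j} \<in> E \<longleftrightarrow> dist (p i) (p j) = 1"
    and card: "card V \<ge> 5"
  shows "dim (lifted_dependencies p V) \<le> mu V (compl_edges V E)"
proof -
  let ?F = "compl_edges V E"
  have "\<exists>a\<in>V. \<exists>b\<in>V. (dist (p a) (p b))\<^sup>2 > 2"
    using card sep by (intro exists_distant_pair) auto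
  then obtain a b where ab: "a \<in> V" "b \<in> V" "(dist (p a) (p b))\<^sup>2 > 2"
    by blast
  then have "a \<noteq> b" "dist (p a) (p b) \<noteq> 1" by auto
  then have abF: "{a, b} \<in> ?F" using contact ab by (simp add: mem_compl_edges_iff)
  define C where "C = {v \<in> V. joined ?F a v}"
  have CV: "C \<subseteq> V" by (auto simp: C_def)
  have inC: "a \<in> C" "b \<in> C" using ab abF by (auto simp: C_def joined_def)
  have block: "dist (p i) (p j) = 1" if "i \<in> C" "j \<in> V - C" for i j
  proof (rule ccontr)
    assume "dist (p i) (p j) \<noteq> 1"
    then have "{i, j} \<in> ?F" using that CV contact by (auto simp: mem_compl_edges_iff)
    moreover have "joined ?F a i" using that by (simp add: C_def)
    ultimately have "joined ?F a j" unfolding joined_def by (simp add: rtranclp.rtrancl_into_rtrancl)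
    then show False using that by (simp add: C_def)
  qed
  define z :: "real ^ 'a" where "z = 1 *\<^sub>R axis a 1 + 1 *\<^sub>R axis b 1"
  have zC: "z \<in> coord_space C" using inC by (auto simp: z_def coord_space_def axis_def)
  have zneg: "z \<bullet> (M *v z) < 0"
    unfolding z_def quadratic_form_add[OF transpose_disk_matrix] axis_form
    using ab by (simp add: disk_matrix_def)
  have cdv: "colin_de_verdiere_matrix C (induced_edges ?F C) (disk_matrix p C)"
    by (rule colin_de_verdiere_disk_matrix[OF contact CV block zC zneg])
  have "lifted_dependencies p V \<subseteq> {x \<in> coord_space C. disk_matrix p C *v x = 0}"
  proof
    fix x assume x: "x \<in> lifted_dependencies p V"
    then have "M *v x = 0"
      by (simp add: lifted_dependencies_def vec_eq_iff disk_matrix_mult_nth disk_matrix_row)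
    moreover have "x \<in> coord_space V" using x by (simp add: lifted_dependencies_def)
    ultimately show "x \<in> {x \<in> coord_space C. disk_matrix p C *v x = 0}"
      using kernel_in_negative_block[OF CV block zC zneg, of x] block_matrix_mult[OF CV block, of x]
      by auto
  qed
  then have "dim (lifted_dependencies p V) \<le> corank C (disk_matrix p C)"
    unfolding corank_def by (rule dim_subset)
  also have "\<dots> \<le> mu_connected C (induced_edges ?F C)" by (rule mu_connected_ge_corank[OF cdv])
  also have "\<dots> \<le> mu V ?F"
  proof (rule mu_ge_component)
    show "C \<in> components_of V ?F" using ab by (auto simp: C_def components_of_def)
  qed (use abF in \<open>auto simp: compl_edges_def\<close>)
  finally show ?thesis .
qed

section \<open>Affine dependencies of special configurations\<close>

lemma dim_lifted_dependencies_ge: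
  fixes V :: "'a::finite set" and fs :: "('a \<Rightarrow> real) list"
  assumes "\<And>x :: real ^ 'a. x \<in> coord_space V \<Longrightarrow> (\<forall>f\<in>set fs. (\<Sum>i\<in>V. f i * x $ i) = 0)
      \<Longrightarrow> x \<in> lifted_dependencies p V"
  shows "card V - length fs \<le> dim (lifted_dependencies p V)"
proof -
  define vec where "vec f = (\<chi> i. if i \<in> V then f i else 0)" for f :: "'a \<Rightarrow> real"
  have inner: "vec f \<bullet> x = (\<Sum>i\<in>V. f i * x $ i)" for f x
    by (simp add: vec_def inner_vec_def if_distrib[of "\<lambda>t. t * _"] sum.If_cases cong: if_cong)
  have "card V - length fs \<le> dim {x \<in> coord_space V. \<forall>w\<in>vec ` set fs. w \<bullet> x = 0}"
  proof (rule dim_orthogonal_ge)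
    show "vec ` set fs \<subseteq> coord_space V" by (auto simp: vec_def coord_space_def)
    show "card (vec ` set fs) \<le> length fs"
      using card_image_le[of "set fs" vec] card_length[of fs] by simp
  qed simp
  also have "\<dots> \<le> dim (lifted_dependencies p V)"
    using assms by (intro dim_subset) (auto simp: inner)
  finally show ?thesis .
qed

lemma sum_scaleR_complex_eq_0_iff:
  "(\<Sum>i\<in>V. x i *\<^sub>R p i) = (0::complex) \<longleftrightarrow> (\<Sum>i\<in>V. Re (p i) * x i) = 0 \<and> (\<Sum>i\<in>V. Im (p i) * x i) = 0"
  by (simp add: complex_eq_iff mult.commute)

lemma dim_lifted_dependencies_general:
  fixes V :: "'a::finite set"
  shows "card V - 4 \<le> dim (lifted_dependencies p V)"
  using dim_lifted_dependencies_ge[of V "[\<lambda>i. 1, \<lambda>i. Re (p i), \<lambda>i. Im (p i), \<lambda>i. (cmod (p i))\<^sup>2]" p]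
  by (simp add: lifted_dependencies_def sum_scaleR_complex_eq_0_iff mult.commute)

lemma dim_lifted_dependencies_collinear:
  fixes V :: "'a::finite set"
  assumes "\<And>i. i \<in> V \<Longrightarrow> Im (p i) = 0"
  shows "card V - 3 \<le> dim (lifted_dependencies p V)"
  using assms
    dim_lifted_dependencies_ge[of V "[\<lambda>i. 1, \<lambda>i. Re (p i), \<lambda>i. (cmod (p i))\<^sup>2]" p]
  by (simp add: lifted_dependencies_def sum_scaleR_complex_eq_0_iff mult.commute)

text \<open>On a circle around the origin the squared norms are constant, so annihilating them is no extra
  condition.\<close>

lemma dim_lifted_dependencies_cocircular:
  fixes V :: "'a::finite set"
  assumes "\<And>i. i \<in> V \<Longrightarrow> cmod (p i) = r"
  shows "card V - 3 \<le> dim (lifted_dependencies p V)"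
  using assms
    dim_lifted_dependencies_ge[of V "[\<lambda>i. 1, \<lambda>i. Re (p i), \<lambda>i. Im (p i)]" p]
  by (simp add: lifted_dependencies_def sum_scaleR_complex_eq_0_iff mult.commute[of "Re _"]
      mult.commute[of "Im _"] flip: sum_distrib_right)

section \<open>Realizations by touching disks\<close>

definition contact_realization :: "'a set \<Rightarrow> 'a set set \<Rightarrow> ('a \<Rightarrow> complex) \<Rightarrow> bool" where
  "contact_realization V E p \<longleftrightarrow> (\<forall>i\<in>V. \<forall>j\<in>V. i \<noteq> j \<longrightarrow>
     dist (p i) (p j) \<ge> 1 \<and> ({i, j} \<in> E \<longleftrightarrow> dist (p i) (p j) = 1))"

lemma mu_compl_ge_dim:
  fixes V :: "'a::finite set"
  assumes "contact_realization V E p" "card V \<ge> 5"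
  shows "dim (lifted_dependencies p V) \<le> mu V (compl_edges V E)"
proof -
  interpret separated_points V p
    using assms(1) by unfold_locales (auto simp: contact_realization_def)
  show ?thesis
    using assms by (intro mu_ge_dim_lifted_dependencies) (auto simp: contact_realization_def)
qed

lemma penny_graph_contact_realization:
  assumes "penny_graph V E"
  shows "\<exists>p. contact_realization V E p"
proof -
  obtain q :: "'a \<Rightarrow> real ^ 2" where q: "\<And>i j. i \<in> V \<Longrightarrow> j \<in> V \<Longrightarrow> i \<noteq> j \<Longrightarrow>
      if {i, j} \<in> E then (norm (q i - q j))\<^sup>2 = 1 else (norm (q i - q j))\<^sup>2 > 1"
    using assms unfolding penny_graph_iff_realization by blast
  define p where "p i = Complex (q i $ 1) (q i $ 2)" for i
  have eq: "(dist (p i) (p j))\<^sup>2 = (norm (q i - q j))\<^sup>2" for i j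
    unfolding dist_norm cmod_power2 p_def power2_norm_eq_inner
    by (simp add: inner_vec_def sum_2 power2_eq_square)
  have "dist (p i) (p j) \<ge> 1 \<and> ({i, j} \<in> E \<longleftrightarrow> dist (p i) (p j) = 1)"
    if "i \<in> V" "j \<in> V" "i \<noteq> j" for i j
    using q[OF that] power2_eq_iff_nonneg[of "dist (p i) (p j)" 1] power2_le_imp_le[of 1 "dist (p i) (p j)"]
    unfolding eq[symmetric] by (auto split: if_splits)
  then show ?thesis by (auto simp: contact_realization_def)
qed

lemma path_graph_positions:
  assumes "path_graph V E"
  obtains s :: "'a \<Rightarrow> nat" where "inj_on s V" "\<And>i. i \<in> V \<Longrightarrow> s i < card V"
    "\<And>i j. i \<in> V \<Longrightarrow> j \<in> V \<Longrightarrow> {i, j} \<in> E \<longleftrightarrow> s i = Suc (s j) \<or> s j = Suc (s i)"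
proof -
  obtain f where f: "bij_betw f {..<card V} V" "E = {{f i, f (Suc i)} |i. Suc i < card V}"
    using assms by (auto simp: path_graph_def)
  define s where "s = inv_into {..<card V} f"
  have bij: "bij_betw s V {..<card V}" unfolding s_def by (rule bij_betw_inv_into[OF f(1)])
  have fs: "f (s i) = i" if "i \<in> V" for i
    unfolding s_def using f(1) that by (simp add: bij_betw_inv_into_right)
  have sf: "s (f k) = k" if "k < card V" for k
    unfolding s_def using f(1) that by (simp add: bij_betw_inv_into_left)
  show ?thesis
  proof
    show "inj_on s V" using bij by (simp add: bij_betw_def)
    show less: "s i < card V" if "i \<in> V" for i using bij that by (auto simp: bij_betw_def)
    fix i j assume ij: "i \<in> V" "j \<in> V"
    show "{i, j} \<in> E \<longleftrightarrow> s i = Suc (s j) \<or> s j = Suc (s i)"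
    proof
      assume "{i, j} \<in> E"
      then obtain k where k: "{i, j} = {f k, f (Suc k)}" "Suc k < card V" by (auto simp: f(2))
      then have "s i = k \<and> s j = Suc k \<or> s i = Suc k \<and> s j = k"
        by (auto simp: doubleton_eq_iff sf)
      then show "s i = Suc (s j) \<or> s j = Suc (s i)" by auto
    next
      assume "s i = Suc (s j) \<or> s j = Suc (s i)"
      then have "{i, j} = {f (s j), f (Suc (s j))} \<and> Suc (s j) < card V
          \<or> {i, j} = {f (s i), f (Suc (s i))} \<and> Suc (s i) < card V"
        using fs[OF ij(1)] fs[OF ij(2)] less[OF ij(1)] less[OF ij(2)] by auto
      then show "{i, j} \<in> E" unfolding f(2) by blast
    qed
  qed
qed

lemma contact_realization_on_line:
  fixes s :: "'a \<Rightarrow> nat"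
  assumes inj: "inj_on s V"
    and adj: "\<And>i j. i \<in> V \<Longrightarrow> j \<in> V \<Longrightarrow> i \<noteq> j \<Longrightarrow> {i, j} \<in> E \<longleftrightarrow> s i = Suc (s j) \<or> s j = Suc (s i)"
  shows "contact_realization V E (\<lambda>i. of_nat (s i))"
proof -
  have dist: "dist (of_nat (s i) :: complex) (of_nat (s j)) = real_of_int \<bar>int (s i) - int (s j)\<bar>" for i j
  proof -
    have "(of_nat (s i) :: complex) - of_nat (s j) = of_int (int (s i) - int (s j))" by simp
    then show ?thesis unfolding dist_norm by (simp only: norm_of_int)
  qed
  have "dist (of_nat (s i) :: complex) (of_nat (s j)) \<ge> 1
      \<and> ({i, j} \<in> E \<longleftrightarrow> dist (of_nat (s i) :: complex) (of_nat (s j)) = 1)"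
    if ij: "i \<in> V" "j \<in> V" "i \<noteq> j" for i j
  proof -
    have "s i \<noteq> s j" using inj ij by (auto simp: inj_on_def)
    then have "\<bar>int (s i) - int (s j)\<bar> \<ge> 1"
      "\<bar>int (s i) - int (s j)\<bar> = 1 \<longleftrightarrow> s i = Suc (s j) \<or> s j = Suc (s i)" by linarith+
    then show ?thesis unfolding dist adj[OF ij] of_int_1_le_iff of_int_eq_1_iff by blast
  qed
  then show ?thesis by (simp add: contact_realization_def)
qed

lemma joined_sym: "joined E u v \<Longrightarrow> joined E v u"
  unfolding joined_def
  by (rule sympD[OF symp_rtranclp]) (auto simp: symp_def insert_commute)

lemma joined_trans: "joined E u v \<Longrightarrow> joined E v w \<Longrightarrow> joined E u w"
  unfolding joined_def by (rule rtranclp_trans)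

text \<open>The components are laid out one after another in slots of length \<open>card V + 1\<close>; a path has at most
  \<open>card V\<close> nodes, so the last integer of each slot stays free and paths in different slots do not touch.\<close>

lemma disjoint_union_of_paths_positions:
  fixes V :: "'a set"
  assumes fin: "finite V" and paths: "disjoint_union_of_paths V E"
  obtains s :: "'a \<Rightarrow> nat" where "inj_on s V"
    "\<And>i j. i \<in> V \<Longrightarrow> j \<in> V \<Longrightarrow> {i, j} \<in> E \<longleftrightarrow> s i = Suc (s j) \<or> s j = Suc (s i)"
proof -
  define comp where "comp v = {u \<in> V. joined E v u}" for v
  have comp: "comp v \<in> components_of V E" "v \<in> comp v" "comp v \<subseteq> V" if "v \<in> V" for v
    using that by (auto simp: comp_def components_of_def joined_def)
  have compE: "comp v = C" if "C \<in> components_of V E" "v \<in> C" for v C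
    using that joined_sym joined_trans unfolding components_of_def comp_def by fast
  have "\<forall>C\<in>components_of V E. \<exists>t :: 'a \<Rightarrow> nat. inj_on t C \<and> (\<forall>i\<in>C. t i < card C) \<and>
      (\<forall>i\<in>C. \<forall>j\<in>C. {i, j} \<in> induced_edges E C \<longleftrightarrow> t i = Suc (t j) \<or> t j = Suc (t i))"
  proof
    fix C assume "C \<in> components_of V E"
    then have "path_graph C (induced_edges E C)" using paths by (simp add: disjoint_union_of_paths_def)
    then show "\<exists>t :: 'a \<Rightarrow> nat. inj_on t C \<and> (\<forall>i\<in>C. t i < card C) \<and>
      (\<forall>i\<in>C. \<forall>j\<in>C. {i, j} \<in> induced_edges E C \<longleftrightarrow> t i = Suc (t j) \<or> t j = Suc (t i))"
      by (rule path_graph_positions) (intro exI conjI ballI)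
  qed
  from bchoice[OF this] obtain t :: "'a set \<Rightarrow> 'a \<Rightarrow> nat"
    where "\<forall>C\<in>components_of V E. inj_on (t C) C \<and> (\<forall>i\<in>C. t C i < card C) \<and>
      (\<forall>i\<in>C. \<forall>j\<in>C. {i, j} \<in> induced_edges E C \<longleftrightarrow> t C i = Suc (t C j) \<or> t C j = Suc (t C i))"
    by (elim exE)
  then have t: "inj_on (t C) C" "i \<in> C \<Longrightarrow> t C i < card C"
    "i \<in> C \<Longrightarrow> j \<in> C \<Longrightarrow>
      {i, j} \<in> induced_edges E C \<longleftrightarrow> t C i = Suc (t C j) \<or> t C j = Suc (t C i)"
    if "C \<in> components_of V E" for C i j
    using that by simp_all
  have "finite (components_of V E)"
    using fin by (simp add: components_of_def setcompr_eq_image)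
  then obtain idx :: "'a set \<Rightarrow> nat" where idx: "inj_on idx (components_of V E)"
    using finite_imp_inj_to_nat_seg by meson
  define N where "N = card V + 1"
  define s where "s v = idx (comp v) * N + t (comp v) v" for v
  have tN: "t (comp v) v + 1 < N" if "v \<in> V" for v
    using t(2)[OF comp(1,2)[OF that]] card_mono[OF fin comp(3)[OF that]] by (simp add: N_def)
  have far: "s i \<noteq> s j \<and> s i \<noteq> Suc (s j)" if ij: "i \<in> V" "j \<in> V" "comp i \<noteq> comp j" for i j
  proof -
    have "idx (comp i) \<noteq> idx (comp j)"
      using idx comp(1) ij by (auto simp: inj_on_def)
    then consider "idx (comp i) + 1 \<le> idx (comp j)" | "idx (comp j) + 1 \<le> idx (comp i)" by linarith
    then show ?thesis
    proof cases
      case 1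
      then have "(idx (comp i) + 1) * N \<le> idx (comp j) * N" by (rule mult_le_mono1)
      then show ?thesis using tN[OF ij(1)] by (simp add: s_def)
    next
      case 2
      then have "(idx (comp j) + 1) * N \<le> idx (comp i) * N" by (rule mult_le_mono1)
      then show ?thesis using tN[OF ij(2)] by (simp add: s_def)
    qed
  qed
  show ?thesis
  proof
    show "inj_on s V"
    proof (rule inj_onI)
      fix i j assume ij: "i \<in> V" "j \<in> V" "s i = s j"
      then have c: "comp i = comp j" using far by blast
      then have "t (comp i) i = t (comp i) j" using ij by (simp add: s_def)
      moreover have "i \<in> comp i" "j \<in> comp i" using comp(2) ij c by auto
      ultimately show "i = j" using t(1)[OF comp(1)[OF ij(1)]] by (auto simp: inj_on_def)
    qed
    fix i j assume ij: "i \<in> V" "j \<in> V"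
    show "{i, j} \<in> E \<longleftrightarrow> s i = Suc (s j) \<or> s j = Suc (s i)"
    proof (cases "comp i = comp j")
      case True
      have m: "i \<in> comp i" "j \<in> comp i" using comp(2) ij True by auto
      then have "{i, j} \<in> E \<longleftrightarrow> {i, j} \<in> induced_edges E (comp i)" by (simp add: induced_edges_def)
      also have "\<dots> \<longleftrightarrow> s i = Suc (s j) \<or> s j = Suc (s i)"
        using t(3)[OF comp(1)[OF ij(1)] m] True by (simp add: s_def)
      finally show ?thesis .
    next
      case False
      have "{i, j} \<notin> E"
      proof
        assume "{i, j} \<in> E"
        then have "j \<in> comp i" using ij by (auto simp: comp_def joined_def)
        then show False using compE[OF comp(1)[OF ij(1)]] False by auto
      qed
      then show ?thesis using far[OF ij] far[OF ij(2,1)] False by auto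
    qed
  qed
qed

lemma dist_rcis:
  assumes "r \<ge> 0"
  shows "dist (rcis r a) (rcis r b) = 2 * r * \<bar>sin ((a - b) / 2)\<bar>"
proof -
  have "(dist (rcis r a) (rcis r b))\<^sup>2 = 2 * r\<^sup>2 * (1 - cos (a - b))"
  proof -
    have ident: "(r * x - r * u)\<^sup>2 + (r * y - r * v)\<^sup>2
        = r\<^sup>2 * (x\<^sup>2 + y\<^sup>2) + r\<^sup>2 * (u\<^sup>2 + v\<^sup>2) - 2 * r\<^sup>2 * (x * u + y * v)" for x y u v
      by (simp add: power2_eq_square algebra_simps)
    have "(dist (rcis r a) (rcis r b))\<^sup>2 = r\<^sup>2 * ((cos a)\<^sup>2 + (sin a)\<^sup>2) + r\<^sup>2 * ((cos b)\<^sup>2 + (sin b)\<^sup>2)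
        - 2 * r\<^sup>2 * cos (a - b)"
      unfolding dist_norm cmod_power2 cos_diff ident[symmetric] by simp
    then show ?thesis by (simp add: right_diff_distrib)
  qed
  also have "1 - cos (a - b) = 2 * (sin ((a - b) / 2))\<^sup>2"
    using cos_double_sin[of "(a - b) / 2"] by (simp only: mult_2 field_sum_of_halves)
  finally have "(dist (rcis r a) (rcis r b))\<^sup>2 = (2 * r * \<bar>sin ((a - b) / 2)\<bar>)\<^sup>2"
    by (simp add: power_mult_distrib)
  then show ?thesis
    by (rule power2_eq_imp_eq) (use assms in simp_all)
qed

text \<open>Up to scaling, these are the lengths of the sides and diagonals of a regular \<open>n\<close>-gon: the sides are the
  shortest.\<close>

lemma sin_multiple_ge:
  fixes n d :: nat
  assumes n: "n \<ge> 3" and d: "1 \<le> d" "d < n"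
  shows "sin (pi * d / n) \<ge> sin (pi / n)"
    and "sin (pi * d / n) = sin (pi / n) \<longleftrightarrow> d = 1 \<or> d = n - 1"
proof -
  have main: "sin (pi * m / n) \<ge> sin (pi / n) \<and> (sin (pi * m / n) = sin (pi / n) \<longleftrightarrow> m = 1)"
    if m: "1 \<le> m" "2 * m \<le> n" for m :: nat
  proof (cases "m = 1")
    case False
    have "pi / n < pi * m / n" using False m n by (simp add: divide_strict_right_mono)
    moreover have "pi * m / n \<le> pi / 2"
    proof -
      have "real (2 * m) \<le> real n" using m by (intro of_nat_mono)
      then have "pi * (2 * real m) \<le> pi * real n" by (intro mult_left_mono) auto
      then show ?thesis using n by (simp add: field_simps)
    qed
    moreover have "- (pi / 2) \<le> pi / n"
      by (rule order_trans[of _ 0]) auto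
    ultimately have "sin (pi / n) < sin (pi * m / n)" by (intro sin_monotone_2pi) auto
    then show ?thesis using False by auto
  qed simp
  have "sin (pi * d / n) \<ge> sin (pi / n) \<and> (sin (pi * d / n) = sin (pi / n) \<longleftrightarrow> d = 1 \<or> d = n - 1)"
  proof (cases "2 * d \<le> n")
    case True
    then show ?thesis using main[OF d(1)] n d by auto
  next
    case False
    have "pi * real (n - d) / n = pi - pi * d / n" using d n by (simp add: of_nat_diff field_simps)
    then have "sin (pi * real (n - d) / n) = sin (pi * d / n)" by (simp only: sin_pi_minus)
    moreover have "1 \<le> n - d" "2 * (n - d) \<le> n" using False d by auto
    ultimately show ?thesis using main[of "n - d"] False d n by auto
  qed
  then show "sin (pi * d / n) \<ge> sin (pi / n)"
    "sin (pi * d / n) = sin (pi / n) \<longleftrightarrow> d = 1 \<or> d = n - 1" by auto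
qed

lemma cyclic_successor_iff:
  fixes a b n :: nat
  assumes "a < n" "b < n" "a \<noteq> b"
  defines "d \<equiv> if a < b then b - a else a - b"
  shows "b = Suc a mod n \<or> a = Suc b mod n \<longleftrightarrow> d = 1 \<or> d = n - 1"
proof -
  have "Suc a mod n = (if Suc a = n then 0 else Suc a)" "Suc b mod n = (if Suc b = n then 0 else Suc b)"
    using assms by auto
  then show ?thesis using assms(1-3) unfolding d_def
    by (cases "Suc a = n"; cases "Suc b = n"; cases "a < b") auto
qed

text \<open>The nodes are placed, in cyclic order, at the vertices of a regular polygon of side length 1.\<close>

lemma cycle_graph_contact_realization:
  assumes "cycle_graph V E"
  obtains p r where "contact_realization V E p" "\<And>i. i \<in> V \<Longrightarrow> cmod (p i) = r"
proof -
  define n where "n = card V"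
  obtain f where f: "bij_betw f {..<n} V" "E = {{f i, f (Suc i mod n)} |i. i < n}" and n: "n \<ge> 3"
    using assms by (auto simp: cycle_graph_def n_def)
  define s where "s = inv_into {..<n} f"
  have fs: "f (s i) = i" "s i < n" if "i \<in> V" for i
    unfolding s_def using f(1) that bij_betw_inv_into[OF f(1)]
    by (auto simp: bij_betw_inv_into_right bij_betw_def)
  have sf: "s (f k) = k" if "k < n" for k
    unfolding s_def using f(1) that by (simp add: bij_betw_inv_into_left)
  have E: "{i, j} \<in> E \<longleftrightarrow> s j = Suc (s i) mod n \<or> s i = Suc (s j) mod n" if "i \<in> V" "j \<in> V" for i j
  proof
    assume "{i, j} \<in> E"
    then obtain k where "{i, j} = {f k, f (Suc k mod n)}" "k < n" by (auto simp: f(2))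
    moreover have "s (f (Suc k mod n)) = Suc k mod n" using n by (intro sf) simp
    ultimately show "s j = Suc (s i) mod n \<or> s i = Suc (s j) mod n"
      by (auto simp: doubleton_eq_iff sf)
  next
    assume "s j = Suc (s i) mod n \<or> s i = Suc (s j) mod n"
    then have "{i, j} = {f (s i), f (Suc (s i) mod n)} \<or> {i, j} = {f (s j), f (Suc (s j) mod n)}"
      using fs(1) that by (metis insert_commute)
    then show "{i, j} \<in> E" unfolding f(2) using fs(2) that by blast
  qed
  have sinpos: "sin (pi / n) > 0" using n by (intro sin_gt_zero) (auto simp: field_simps)
  define r where "r = 1 / (2 * sin (pi / n))"
  have r: "r > 0" using sinpos by (simp add: r_def)
  define p where "p i = rcis r (2 * pi * s i / n)" for i
  have "dist (p i) (p j) \<ge> 1 \<and> ({i, j} \<in> E \<longleftrightarrow> dist (p i) (p j) = 1)"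
    if ij: "i \<in> V" "j \<in> V" "i \<noteq> j" for i j
  proof -
    define d where "d = (if s i < s j then s j - s i else s i - s j)"
    have ne: "s i \<noteq> s j" using fs(1) ij by metis
    then have d: "1 \<le> d" "d < n" using fs(2)[OF ij(1)] fs(2)[OF ij(2)] by (auto simp: d_def)
    have "sin (pi * d / n) > 0" using sin_multiple_ge(1)[OF n d] sinpos by linarith
    moreover have "\<bar>sin (pi * (real (s i) - real (s j)) / n)\<bar> = \<bar>sin (pi * d / n)\<bar>"
    proof (cases "s j \<le> s i")
      case True
      then have "real d = real (s i) - real (s j)" by (simp add: d_def)
      then show ?thesis by simp
    next
      case False
      then have "real (s i) - real (s j) = - real d" by (simp add: d_def)
      then show ?thesis by simp
    qed
    moreover have "(2 * pi * s i / n - 2 * pi * s j / n) / 2 = pi * (real (s i) - real (s j)) / n"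
      by (simp add: diff_divide_distrib right_diff_distrib)
    ultimately have "dist (p i) (p j) = 2 * r * sin (pi * d / n)"
      unfolding p_def using r by (simp add: dist_rcis)
    then have dist: "dist (p i) (p j) = sin (pi * d / n) / sin (pi / n)" by (simp add: r_def)
    have "{i, j} \<in> E \<longleftrightarrow> d = 1 \<or> d = n - 1"
      using E[OF ij(1,2)] cyclic_successor_iff[OF fs(2) fs(2) ne] ij by (simp add: d_def)
    then show ?thesis
      unfolding dist using sin_multiple_ge[OF n d] sinpos
      by (simp add: le_divide_eq divide_eq_eq)
  qed
  then have "contact_realization V E p" by (simp add: contact_realization_def)
  moreover have "cmod (p i) = r" for i using r by (simp add: p_def)
  ultimately show ?thesis by (rule that)
qed

section \<open>Penny graphs\<close>

theorem theorem1p4: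
  fixes V :: "('a::finite) set" and E :: "'a set set" and n :: nat
  assumes "simple_graph V E"
    and "penny_graph V E"
    and "card V = n"
    and "n \<ge> 5"
  shows "(path_graph V E \<or> disjoint_union_of_paths V E \<or> cycle_graph V E \<longrightarrow>
            mu V (compl_edges V E) \<ge> n - 3) \<and>
         (\<not> (path_graph V E \<or> disjoint_union_of_paths V E \<or> cycle_graph V E) \<longrightarrow>
            mu V (compl_edges V E) \<ge> n - 4)"
proof (intro conjI impI)
  have card: "card V \<ge> 5" using assms by simp
  have line: "mu V (compl_edges V E) \<ge> n - 3"
    if "inj_on s V" "\<And>i j. i \<in> V \<Longrightarrow> j \<in> V \<Longrightarrow> {i, j} \<in> E \<longleftrightarrow> s i = Suc (s j) \<or> s j = Suc (s i)"
    for s :: "'a \<Rightarrow> nat"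
    using dim_lifted_dependencies_collinear[of V "\<lambda>i. of_nat (s i)"]
      mu_compl_ge_dim[OF contact_realization_on_line[OF that] card] assms(3)
    by simp
  assume "path_graph V E \<or> disjoint_union_of_paths V E \<or> cycle_graph V E"
  then show "mu V (compl_edges V E) \<ge> n - 3"
  proof (elim disjE)
    assume "path_graph V E"
    then show ?thesis by (rule path_graph_positions) (rule line)
  next
    assume "disjoint_union_of_paths V E"
    then show ?thesis by (rule disjoint_union_of_paths_positions[OF finite]) (rule line)
  next
    assume "cycle_graph V E"
    then obtain p r where p: "contact_realization V E p" "\<And>i. i \<in> V \<Longrightarrow> cmod (p i) = r"
      using cycle_graph_contact_realization by blast
    show ?thesis
      using dim_lifted_dependencies_cocircular[of V p r, OF p(2)] mu_compl_ge_dim[OF p(1) card] assms(3)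
      by simp
  qed
next
  obtain p where p: "contact_realization V E p"
    using penny_graph_contact_realization[OF assms(2)] by blast
  show "mu V (compl_edges V E) \<ge> n - 4"
    using dim_lifted_dependencies_general[of V p] mu_compl_ge_dim[OF p] assms(3,4)
    by simp
qed

end
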